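(* Let $N\ge1$ be an integer and let $\vec S\in\mathbb{R}^{2^N-1}$ be an irreducible $N$-party entropy vector such that the line graph $L_{\mathcal P}$ of its correlation hypergraph is chordal. Then any holographic simple tree graph model $T$ resulting from the tree construction applied to $\vec S$ (for any choice of maximum spanning tree $\widetilde T$) is a realization of $\vec S$; that is, for every non-empty $X\subseteq[N]$ the minimum cost of an $X$-cut in $T$ equals $S_X$.
   Context: Parties and entropy vectors. Fix $N\ge1$. Let $[N]=\{1,\dots,N\}$ and $\llbracket N\rrbracket=\{0,1,\dots,N\}$, where $0$ is called the purifier. An entropy vector is a vector $\vec S=(S_X)_{\varnothing\ne X\subseteq[N]}\in\mathbb{R}^{2^N-1}$ of real numbers. It is extended to all $X\subseteq\llbracket N\rrbracket$ by $S_{\varnothing}=S_{\llbracket N\rrbracket}=0$ and, if $0\in X$, $S_X=S_{\llbracket N\rrbracket\setminus X}$. For disjoint $X,Y\subseteq\llbracket N\rrbracket$ put $I(X:Y)=S_X+S_Y-S_{X\cup Y}$. SA: $I(X:Y)\ge0$ for all disjoint non-empty $X,Y\subseteq\llbracket N\rrbracket$. SSA: $I(X:Y\cup Z)\ge I(X:Y)$ for all pairwise disjoint non-empty $X,Y,Z\subseteq\llbracket N\rrbracket$. Correlation hypergraph. For $\vec S$ satisfying SA and SSA, let $\mathcal P$ be the set of mutual information instances $I(X:Y)$ ($X,Y$ disjoint, non-empty) that vanish on $\vec S$. A subsystem $X\subseteq\llbracket N\rrbracket$ with $|X|\ge2$ is said to have positive $\beta$-set if $I(Y:Z)\notin\mathcal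 P$ (i.e. $I(Y:Z)>0$) for every bipartition $\{Y,Z\}$ of $X$ into two non-empty parts. The correlation hypergraph $H_{\mathcal P}$ has vertex set $\{v_\ell:\ell\in\llbracket N\rrbracket\}$ and one hyperedge $h_X=\{v_\ell:\ell\in X\}$ for each $X$, $|X|\ge2$, with positive $\beta$-set. Its line graph $L_{\mathcal P}$ has the hyperedges as vertices, two distinct hyperedges being adjacent iff they intersect. A graph is chordal if it contains no cycle of length four or more without a chord. Irreducibility. A max-clique is an inclusion-maximal clique. For a max-clique $Q$ of $L_{\mathcal P}$ let $Q^\cap=\bigcap_{h_X\in Q}h_X$. The vector $\vec S$ is irreducible if it satisfies all instances of SA and SSA, $S_X\neq0$ for all non-empty $X\subseteq[N]$, and $Q^\cap=\varnothing$ for all max-cliques $Q$ of $L_{\mathcal P}$. Tree construction. Let $\vec S$ be irreducible with $L_{\mathcal P}$ chordal. (1) Let $K_{\mathcal P}$ be the weighted clique graph of $L_{\mathcal P}$: its vertices $v_Q$ are the max-cliques $Q$ of $L_{\mathcal P}$, distinct $v_Q,v_{Q'}$ are adjacent iff $Q\cap Q'\ne\varnothing$, and this edge has weight $|Q\cap Q'|$. (2) Choose any maximum-weight spanning tree $\widetilde T$ of $K_{\mathcal P}$. (It is a clique tree of $L_{\mathcal P}$: for each vertex of $L_{\mathcal P}$ the max-cliques containing it induce a subtree.) (3) For each party $\ell\in\llbracket N\rrbracket$ let $Q^\ell$ be the clique of $L_{\mathcal P}$ consisting of all hyperedges containing $v_\ell$; it is a known fact that $Q^\ell$ is contained in a unique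 max-clique $Q$; add to $\widetilde T$ a new leaf $v_\ell$ joined by an edge to $v_Q$. Call the resulting tree $T$; its boundary vertices are the $v_\ell$, labeled by $\ell\in\llbracket N\rrbracket$, and its bulk vertices are the $v_Q$. (4) For each edge $e$ of $T$, deleting $e$ splits $T$ into two trees, and hence $\llbracket N\rrbracket$ into two complementary sets of parties $Y,\llbracket N\rrbracket\setminus Y$, with $0\notin Y$; set the weight $w(e)=S_Y$ if $Y\neq\varnothing$ and $w(e)=0$ otherwise. The weighted tree $T$ is a simple tree graph model resulting from the construction. Cuts. For $X\subseteq\llbracket N\rrbracket$ an $X$-cut in $T$ is a set $C$ of vertices of $T$ such that the boundary vertices in $C$ are exactly the $v_\ell$ with $\ell\in X$; its cost $\|C\|$ is the sum of the weights of the edges with exactly one endpoint in $C$. *)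

theory Defs
  imports Complex_Main
begin

section \<open>Finite simple graphs\<close>

record 'v sgraph =
  verts :: "'v set"
  edges :: "'v set set"

definition simple_graph :: "'v sgraph \<Rightarrow> bool" where
  "simple_graph G \<longleftrightarrow> edges G \<subseteq> {{u, v} | u v. u \<in> verts G \<and> v \<in> verts G \<and> u \<noteq> v}"

definition cycle_edges :: "'v list \<Rightarrow> 'v set set" where
  "cycle_edges vs = {{vs ! i, vs ! (Suc i mod length vs)} | i. i < length vs}"

definition cycle_in :: "'v sgraph \<Rightarrow> 'v list \<Rightarrow> bool" where
  "cycle_in G vs \<longleftrightarrow> length vs \<ge> 3 \<and> distinct vs \<and> set vs \<subseteq> verts G \<and> cycle_edges vs \<subseteq> edges G"

definition has_chord :: "'v sgraph \<Rightarrow> 'v list \<Rightarrow> bool" where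
  "has_chord G vs \<longleftrightarrow>
     (\<exists>u \<in> set vs. \<exists>v \<in> set vs. u \<noteq> v \<and> {u, v} \<in> edges G \<and> {u, v} \<notin> cycle_edges vs)"

definition chordal :: "'v sgraph \<Rightarrow> bool" where
  "chordal G \<longleftrightarrow> (\<forall>vs. cycle_in G vs \<and> length vs \<ge> 4 \<longrightarrow> has_chord G vs)"

definition clique :: "'v sgraph \<Rightarrow> 'v set \<Rightarrow> bool" where
  "clique G Q \<longleftrightarrow> Q \<subseteq> verts G \<and> (\<forall>u \<in> Q. \<forall>v \<in> Q. u \<noteq> v \<longrightarrow> {u, v} \<in> edges G)"

definition max_clique :: "'v sgraph \<Rightarrow> 'v set \<Rightarrow> bool" where
  "max_clique G Q \<longleftrightarrow> clique G Q \<and> (\<forall>Q'. clique G Q' \<and> Q \<subseteq> Q' \<longrightarrow> Q' = Q)"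

definition reachable :: "'v sgraph \<Rightarrow> 'v \<Rightarrow> 'v \<Rightarrow> bool" where
  "reachable G = (\<lambda>u v. {u, v} \<in> edges G)\<^sup>*\<^sup>*"

definition tree :: "'v sgraph \<Rightarrow> bool" where
  "tree G \<longleftrightarrow> simple_graph G \<and> verts G \<noteq> {}
     \<and> (\<forall>u \<in> verts G. \<forall>v \<in> verts G. reachable G u v)
     \<and> (\<nexists>vs. cycle_in G vs)"

definition spanning_tree :: "'v sgraph \<Rightarrow> 'v sgraph \<Rightarrow> bool" where
  "spanning_tree G T \<longleftrightarrow> tree T \<and> verts T = verts G \<and> edges T \<subseteq> edges G"

definition max_weight_spanning_tree :: "'v sgraph \<Rightarrow> ('v set \<Rightarrow> nat) \<Rightarrow> 'v sgraph \<Rightarrow> bool" where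
  "max_weight_spanning_tree G w T \<longleftrightarrow> spanning_tree G T
     \<and> (\<forall>T'. spanning_tree G T' \<longrightarrow> sum w (edges T') \<le> sum w (edges T))"

definition delete_edge :: "'v sgraph \<Rightarrow> 'v set \<Rightarrow> 'v sgraph" where
  "delete_edge G e = G\<lparr>edges := edges G - {e}\<rparr>"


section \<open>Entropy vectors\<close>

text \<open>
  An \<open>N\<close>-party entropy vector is given by the values of a function \<open>S :: nat set \<Rightarrow> real\<close> on the
  non-empty subsets of \<open>{1..N}\<close>. Everything below accesses \<open>S\<close> through \<open>entropy N S\<close> on subsets
  of \<open>{0..N}\<close>, or directly on non-empty subsets of \<open>{1..N}\<close>, so its other values play no role.
  The party \<open>0\<close> is the purifier.
\<close>

definition entropy :: "nat \<Rightarrow> (nat set \<Rightarrow> real) \<Rightarrow> nat set \<Rightarrow> real" where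
  "entropy N S X =
     (if X = {} \<or> X = {0..N} then 0 else if 0 \<in> X then S ({0..N} - X) else S X)"

definition mutual_info :: "nat \<Rightarrow> (nat set \<Rightarrow> real) \<Rightarrow> nat set \<Rightarrow> nat set \<Rightarrow> real" where
  "mutual_info N S X Y = entropy N S X + entropy N S Y - entropy N S (X \<union> Y)"

definition SA :: "nat \<Rightarrow> (nat set \<Rightarrow> real) \<Rightarrow> bool" where
  "SA N S \<longleftrightarrow> (\<forall>X Y. X \<subseteq> {0..N} \<and> Y \<subseteq> {0..N} \<and> X \<noteq> {} \<and> Y \<noteq> {} \<and> X \<inter> Y = {}
     \<longrightarrow> mutual_info N S X Y \<ge> 0)"

definition SSA :: "nat \<Rightarrow> (nat set \<Rightarrow> real) \<Rightarrow> bool" where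
  "SSA N S \<longleftrightarrow> (\<forall>X Y Z. X \<subseteq> {0..N} \<and> Y \<subseteq> {0..N} \<and> Z \<subseteq> {0..N}
     \<and> X \<noteq> {} \<and> Y \<noteq> {} \<and> Z \<noteq> {} \<and> X \<inter> Y = {} \<and> X \<inter> Z = {} \<and> Y \<inter> Z = {}
     \<longrightarrow> mutual_info N S X (Y \<union> Z) \<ge> mutual_info N S X Y)"


section \<open>Correlation hypergraph and irreducibility\<close>

text \<open>
  The instance \<open>I(X:Y)\<close> is represented by both ordered pairs \<open>(X, Y)\<close> and \<open>(Y, X)\<close>, and the
  hypergraph vertex \<open>v\<^sub>\<ell>\<close> by \<open>\<ell>\<close> itself, so that \<open>h\<^sub>X\<close> is just \<open>X\<close>.
\<close>

definition vanishing_MI :: "nat \<Rightarrow> (nat set \<Rightarrow> real) \<Rightarrow> (nat set \<times> nat set) set" where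
  "vanishing_MI N S = {(X, Y). X \<subseteq> {0..N} \<and> Y \<subseteq> {0..N} \<and> X \<noteq> {} \<and> Y \<noteq> {} \<and> X \<inter> Y = {}
     \<and> mutual_info N S X Y = 0}"

definition positive_beta_set :: "nat \<Rightarrow> (nat set \<Rightarrow> real) \<Rightarrow> nat set \<Rightarrow> bool" where
  "positive_beta_set N S X \<longleftrightarrow>
     (\<forall>Y Z. Y \<noteq> {} \<and> Z \<noteq> {} \<and> Y \<inter> Z = {} \<and> Y \<union> Z = X \<longrightarrow> (Y, Z) \<notin> vanishing_MI N S)"

definition hyperedges :: "nat \<Rightarrow> (nat set \<Rightarrow> real) \<Rightarrow> nat set set" where
  "hyperedges N S = {X. X \<subseteq> {0..N} \<and> card X \<ge> 2 \<and> positive_beta_set N S X}"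

definition line_graph :: "nat \<Rightarrow> (nat set \<Rightarrow> real) \<Rightarrow> nat set sgraph" where
  "line_graph N S = \<lparr>verts = hyperedges N S,
     edges = {{h, h'} | h h'. h \<in> hyperedges N S \<and> h' \<in> hyperedges N S \<and> h \<noteq> h' \<and> h \<inter> h' \<noteq> {}}\<rparr>"

definition irreducible_entropy :: "nat \<Rightarrow> (nat set \<Rightarrow> real) \<Rightarrow> bool" where
  "irreducible_entropy N S \<longleftrightarrow> SA N S \<and> SSA N S
     \<and> (\<forall>X. X \<subseteq> {1..N} \<and> X \<noteq> {} \<longrightarrow> S X \<noteq> 0)
     \<and> (\<forall>Q. max_clique (line_graph N S) Q \<longrightarrow> \<Inter>Q = {})"


section \<open>The tree construction\<close>

definition clique_graph :: "nat \<Rightarrow> (nat set \<Rightarrow> real) \<Rightarrow> nat set set sgraph" where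
  "clique_graph N S = (let V = {Q. max_clique (line_graph N S) Q} in
     \<lparr>verts = V, edges = {{Q, Q'} | Q Q'. Q \<in> V \<and> Q' \<in> V \<and> Q \<noteq> Q' \<and> Q \<inter> Q' \<noteq> {}}\<rparr>)"

text \<open>For an edge \<open>e = {Q, Q'}\<close> this is the cardinality of \<open>Q \<inter> Q'\<close>.\<close>

definition clique_weight :: "nat set set set \<Rightarrow> nat" where
  "clique_weight e = card (\<Inter>e)"

datatype model_vertex = Boundary nat | Bulk "nat set set"

definition party_clique :: "nat \<Rightarrow> (nat set \<Rightarrow> real) \<Rightarrow> nat \<Rightarrow> nat set set" where
  "party_clique N S l = {h \<in> hyperedges N S. l \<in> h}"

text \<open>
  For irreducible \<open>S\<close> the max-clique described here exists and is unique: if \<open>Q\<close> and \<open>Q'\<close> were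
  two of them, they would contain disjoint hyperedges \<open>X\<close> and \<open>Y\<close> that meet all hyperedges
  through \<open>l\<close>, whence \<open>S\<^sub>X = S\<^sub>l + S\<^sub>X\<^sub>l\<close> and \<open>S\<^sub>Y = S\<^sub>l + S\<^sub>Y\<^sub>l\<close>, and SSA would give \<open>S\<^sub>l \<le> 0\<close>.
\<close>

definition attachment :: "nat \<Rightarrow> (nat set \<Rightarrow> real) \<Rightarrow> nat \<Rightarrow> nat set set" where
  "attachment N S l = (THE Q. max_clique (line_graph N S) Q \<and> party_clique N S l \<subseteq> Q)"

definition add_leaves :: "nat \<Rightarrow> (nat set \<Rightarrow> real) \<Rightarrow> nat set set sgraph \<Rightarrow> model_vertex sgraph" where
  "add_leaves N S T' = \<lparr>verts = Bulk ` verts T' \<union> Boundary ` {0..N},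
     edges = (\<lambda>e. Bulk ` e) ` edges T'
       \<union> {{Boundary l, Bulk (attachment N S l)} | l. l \<in> {0..N}}\<rparr>"

text \<open>
  The parties of the component of \<open>T - e\<close> that does not contain the purifier, where \<open>T\<close> is a tree
  and \<open>e\<close> one of its edges.
\<close>

definition edge_parties :: "nat \<Rightarrow> model_vertex sgraph \<Rightarrow> model_vertex set \<Rightarrow> nat set" where
  "edge_parties N T e =
     {l \<in> {0..N}. \<not> reachable (delete_edge T e) (Boundary 0) (Boundary l)}"

definition edge_weight ::
    "nat \<Rightarrow> (nat set \<Rightarrow> real) \<Rightarrow> model_vertex sgraph \<Rightarrow> model_vertex set \<Rightarrow> real" where
  "edge_weight N S T e = (let Y = edge_parties N T e in if Y \<noteq> {} then S Y else 0)"

definition simple_tree_model ::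
    "nat \<Rightarrow> (nat set \<Rightarrow> real) \<Rightarrow> model_vertex sgraph \<Rightarrow> (model_vertex set \<Rightarrow> real) \<Rightarrow> bool" where
  "simple_tree_model N S T w \<longleftrightarrow>
     (\<exists>T'. max_weight_spanning_tree (clique_graph N S) clique_weight T' \<and> T = add_leaves N S T')
     \<and> (\<forall>e \<in> edges T. w e = edge_weight N S T e)"


section \<open>Cuts and realization\<close>

definition is_cut :: "nat \<Rightarrow> model_vertex sgraph \<Rightarrow> nat set \<Rightarrow> model_vertex set \<Rightarrow> bool" where
  "is_cut N T X C \<longleftrightarrow> C \<subseteq> verts T \<and> C \<inter> Boundary ` {0..N} = Boundary ` X"

definition cut_cost :: "'v sgraph \<Rightarrow> ('v set \<Rightarrow> real) \<Rightarrow> 'v set \<Rightarrow> real" where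
  "cut_cost T w C = (\<Sum>e \<in> {e \<in> edges T. card (e \<inter> C) = 1}. w e)"

definition realizes ::
    "nat \<Rightarrow> model_vertex sgraph \<Rightarrow> (model_vertex set \<Rightarrow> real) \<Rightarrow> (nat set \<Rightarrow> real) \<Rightarrow> bool" where
  "realizes N T w S \<longleftrightarrow>
     (\<forall>X. X \<subseteq> {1..N} \<and> X \<noteq> {} \<longrightarrow> Min {cut_cost T w C | C. is_cut N T X C} = S X)"

end

theory Submission
  imports Defs
begin

text \<open>
  Lower bound: \<open>X\<close> is the iterated symmetric difference of the party sets of the edges crossed by
  an \<open>X\<close>-cut, and entropy is subadditive under symmetric differences by weak monotonicity.

  Upper bound: \<open>X\<close> splits along vanishing mutual informations into single parties and hyperedges,
  and the union of optimal cuts for the pieces is a cut for \<open>X\<close>. For a hyperedge \<open>h\<^sub>X\<close> the cut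
  consists of the parties in \<open>X\<close> and the max-cliques containing \<open>h\<^sub>X\<close>; it is connected because the
  tree is a clique tree. The region of a hyperedge disjoint from \<open>X\<close> avoids this cut and so lies in
  a single branch beyond it. Hence the complement of \<open>X\<close> splits into pieces contained in single
  branches, and subadditivity bounds the cost by its entropy.
\<close>

section \<open>Forests\<close>

text \<open>The upper bound needs entropies to add up against the direction of subadditivity: the
  crossed edges together must not weigh more than the entropy of the complement of \<open>X\<close>.
  Every splitting along a vanishing mutual information is an equality, so this reversal is available
  as soon as no branch cuts a hyperedge contained in that complement; providing this is the purpose
  of the tree. Connectedness of the regions rests on two facts: chordality and maximal weight make
  the spanning tree a clique tree, and the max-clique to which a party is attached is well defined
  and contains all hyperedges through that party. Purity makes the weight of an edge independent of
  the side from which it is read, so the lower bound can be rooted at the purifier and the upper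
  bound at a party inside the cut.\<close>

definition linked :: "'v set set \<Rightarrow> 'v \<Rightarrow> 'v \<Rightarrow> bool" where
  "linked E = (\<lambda>u v. {u, v} \<in> E)\<^sup>*\<^sup>*"

lemma reachable_eq_linked: "reachable G = linked (edges G)"
  by (simp add: reachable_def linked_def)

lemma linked_refl [simp]: "linked E u u"
  by (simp add: linked_def)

lemma linked_trans: "linked E u v \<Longrightarrow> linked E v x \<Longrightarrow> linked E u x"
  by (auto simp: linked_def)

lemma linked_edge: "{u, v} \<in> E \<Longrightarrow> linked E u v"
  by (auto simp: linked_def)

lemma linked_sym: "linked E u v \<Longrightarrow> linked E v u"
  unfolding linked_def
  by (rule sympD[OF symp_rtranclp]) (auto simp: symp_def insert_commute)

lemma linked_trans_back: "linked E x u \<Longrightarrow> linked E x y \<Longrightarrow> linked E v y \<Longrightarrow> linked E u v"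
  using linked_trans[OF linked_trans[OF linked_sym]] linked_sym by metis

lemma linked_mono: "linked E u v \<Longrightarrow> E \<subseteq> E' \<Longrightarrow> linked E' u v"
  unfolding linked_def
  by (erule rtranclp_mono[THEN predicate2D, rotated]) auto

lemma linked_induct [consumes 1, case_names refl step]:
  assumes "linked E u v" "P u"
    and "\<And>x y. linked E u x \<Longrightarrow> {x, y} \<in> E \<Longrightarrow> P x \<Longrightarrow> P y"
  shows "P v"
  using assms(1) unfolding linked_def
  by (induction rule: rtranclp_induct) (auto simp: linked_def intro: assms(2,3))

text \<open>A walk that uses the extra edge several times can be cut down to a single
  passage.\<close>

lemma linked_insert_edge:
  assumes "linked (insert {p, q} E) x y"
  shows "linked E x y \<or> linked E x p \<and> linked E q y \<or> linked E x q \<and> linked E p y"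
  using assms
proof (induction rule: linked_induct)
  case (step y z)
  show ?case
  proof (cases "{y, z} \<in> E")
    case True
    then show ?thesis
      using step.IH linked_edge linked_trans by metis
  next
    case False
    then have "y = p \<and> z = q \<or> y = q \<and> z = p"
      using step.hyps(2) by (auto simp: doubleton_eq_iff)
    then show ?thesis
      using step.IH linked_refl by metis
  qed
qed simp

lemma linked_remove_edge:
  assumes "linked E x y" "{p, q} \<in> E"
  shows "linked (E - {{p, q}}) x y
    \<or> linked (E - {{p, q}}) x p \<and> linked (E - {{p, q}}) q y
    \<or> linked (E - {{p, q}}) x q \<and> linked (E - {{p, q}}) p y"
  using linked_insert_edge[of p q "E - {{p, q}}" x y] assms by (simp add: insert_absorb)

text \<open>Isolates the first edge from \<open>F0\<close> on a walk; applied from both ends of a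
  path it finds the first and the last such edge.\<close>

lemma linked_leaves_set:
  assumes "linked F x y" "\<not> linked (F - F0) x y"
  shows "\<exists>u v. linked (F - F0) x u \<and> {u, v} \<in> F \<inter> F0"
  using assms
proof (induction rule: linked_induct)
  case (step y z)
  then show ?case
    by (metis DiffI IntI linked_edge linked_trans)
qed simp

text \<open>Acyclicity in the form "every edge is a bridge", which needs no lists of vertices. Loops
  are excluded because \<open>linked\<close> is reflexive.\<close>

definition forest :: "'v set set \<Rightarrow> bool" where
  "forest E \<longleftrightarrow> (\<forall>e \<in> E. \<exists>u v. e = {u, v} \<and> \<not> linked (E - {e}) u v)"

lemma forest_bridge:
  assumes "forest E" "{u, v} \<in> E"
  shows "\<not> linked (E - {{u, v}}) u v"
  using assms unfolding forest_def doubleton_eq_iff by (metis (no_types) doubleton_eq_iff linked_sym)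

lemma forestE:
  assumes "forest E" "e \<in> E"
  obtains u v where "e = {u, v}" "u \<noteq> v"
  using assms unfolding forest_def by fastforce

text \<open>The edges in \<open>F\<close> are those of the path from \<open>x\<close> to \<open>y\<close>.\<close>

lemma forest_path:
  assumes "forest E" "finite E" "linked E x y"
  obtains F where "F \<subseteq> E" "linked F x y" "\<And>f. f \<in> F \<Longrightarrow> \<not> linked (E - {f}) x y"
proof -
  have "finite {F. F \<subseteq> E \<and> linked F x y}" "{F. F \<subseteq> E \<and> linked F x y} \<noteq> {}"
    using assms by auto
  then obtain F where F: "F \<subseteq> E" "linked F x y"
    and min: "\<And>F'. F' \<subseteq> E \<Longrightarrow> linked F' x y \<Longrightarrow> F' \<subseteq> F \<Longrightarrow> F = F'"
    using finite_has_minimal[of "{F. F \<subseteq> E \<and> linked F x y}"] by auto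
  have "\<not> linked (E - {f}) x y" if f: "f \<in> F" for f
  proof
    assume xy: "linked (E - {f}) x y"
    obtain u v where uv: "f = {u, v}"
      using assms(1) F(1) f by (meson forestE subsetD)
    have "\<not> linked (F - {f}) x y"
      using min[of "F - {f}"] F f by blast
    then have "linked (F - {f}) x u \<and> linked (F - {f}) v y
        \<or> linked (F - {f}) x v \<and> linked (F - {f}) u y"
      using linked_remove_edge[of F x y u v] F f uv by auto
    moreover have "linked (E - {f}) a b" if "linked (F - {f}) a b" for a b
      using that by (rule linked_mono) (use F in auto)
    ultimately have "linked (E - {f}) u v"
      using xy linked_trans_back[of _ x _ y] linked_sym by metis
    then show False
      using forest_bridge[OF assms(1), of u v] F f uv by auto
  qed
  then show thesis
    using that F by blast
qed

section \<open>Shortest paths and cycles\<close>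

lemma relpowp_least_path:
  assumes "R\<^sup>*\<^sup>* x y"
  obtains p and k :: nat where "p 0 = x" "p k = y" "\<And>i. i < k \<Longrightarrow> R (p i) (p (Suc i))"
    "\<And>i j. i < j \<Longrightarrow> j \<le> k \<Longrightarrow> p i \<noteq> p j"
    "\<And>i j. i < j \<Longrightarrow> j \<le> k \<Longrightarrow> R (p i) (p j) \<Longrightarrow> j = Suc i"
proof -
  obtain n where "(R ^^ n) x y"
    using rtranclp_imp_relpowp[OF assms] by blast
  \<comment> \<open>Minimal length excludes repeated vertices (\<open>cut\<close>) and shortcuts
    (\<open>short\<close>), so the path is simple and induced.\<close>
  then obtain k where k: "(R ^^ k) x y" and least: "\<And>m. (R ^^ m) x y \<Longrightarrow> k \<le> m"
    using ex_has_least_nat[of "\<lambda>k. (R ^^ k) x y" n "\<lambda>k. k"] by blast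
  then obtain p where p: "p 0 = x" "p k = y" "\<And>i. i < k \<Longrightarrow> R (p i) (p (Suc i))"
    unfolding relpowp_fun_conv by blast
  have seg: "(R ^^ (j - i)) (p i) (p j)" if "i \<le> j" "j \<le> k" for i j
    unfolding relpowp_fun_conv
    by (rule exI[of _ "\<lambda>m. p (i + m)"]) (use p that in auto)
  have cut: "(R ^^ (i + (k - j))) x y" if "i < j" "j \<le> k" "p i = p j" for i j
    unfolding relpowp_add using seg[of 0 i] seg[of j k] that p by auto
  have short: "(R ^^ (Suc i + (k - j))) x y" if "i < j" "j \<le> k" "R (p i) (p j)" for i j
    unfolding relpowp_add using seg[of 0 i] seg[of j k] that p by auto
  show thesis
  proof (rule that[OF p])
    show "p i \<noteq> p j" if "i < j" "j \<le> k" for i j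
      using cut[OF that] least[of "i + (k - j)"] that by linarith
    show "j = Suc i" if "i < j" "j \<le> k" "R (p i) (p j)" for i j
      using least[OF short[OF that]] that by linarith
  qed
qed

text \<open>Trades the modulus in \<open>cycle_edges\<close> for consecutive indices and one closing
  edge.\<close>

lemma cycle_edges_map:
  assumes "n > 0"
  shows "cycle_edges (map c [0..<n]) = {{c i, c (Suc i)} | i. Suc i < n} \<union> {{c (n - 1), c 0}}"
    (is "?L = ?A \<union> ?B")
proof
  show "?L \<subseteq> ?A \<union> ?B"
  proof
    fix e
    assume "e \<in> ?L"
    then obtain i where i: "i < n" "e = {c i, c (Suc i mod n)}"
      by (auto simp: cycle_edges_def)
    show "e \<in> ?A \<union> ?B"
    proof (cases "Suc i < n")
      case False
      then have "Suc i = n"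
        using i by simp
      then show ?thesis
        using i by auto
    qed (use i in auto)
  qed
  show "?A \<union> ?B \<subseteq> ?L"
  proof
    fix e
    assume "e \<in> ?A \<union> ?B"
    then consider i where "Suc i < n" "e = {c i, c (Suc i)}" | "e = {c (n - 1), c 0}"
      by blast
    then show "e \<in> ?L"
    proof cases
      case 1
      then show ?thesis
        by (auto simp: cycle_edges_def intro!: exI[of _ i])
    next
      case 2
      then show ?thesis
        using assms by (auto simp: cycle_edges_def intro!: exI[of _ "n - 1"])
    qed
  qed
qed

text \<open>If an edge were no bridge, a shortest detour between its ends would close up with it to
  a cycle.\<close>

lemma tree_forest:
  assumes "tree G"
  shows "forest (edges G)"
  unfolding forest_def
proof
  fix e
  assume e: "e \<in> edges G"
  then obtain u v where uv: "e = {u, v}" "u \<in> verts G" "v \<in> verts G" "u \<noteq> v"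
    using assms unfolding tree_def simple_graph_def by blast
  have "\<not> linked (edges G - {e}) u v"
  proof
    assume uv_linked: "linked (edges G - {e}) u v"
    obtain p k where p: "p 0 = u" "p k = v"
      and step: "\<And>i. i < k \<Longrightarrow> {p i, p (Suc i)} \<in> edges G - {e}"
      and inj: "\<And>i j. i < j \<Longrightarrow> j \<le> k \<Longrightarrow> p i \<noteq> p j"
      by (rule relpowp_least_path[OF uv_linked[unfolded linked_def]]) (rule that)
    have "k \<noteq> 0"
      using p uv(4) by metis
    \<comment> \<open>A detour of one step would be the removed edge \<open>e\<close> itself; two
      steps give the three vertices that a cycle needs.\<close>
    moreover have "k \<noteq> 1"
      using p uv(1) step[of 0] by auto
    ultimately have k: "k \<ge> 2" by simp
    have verts: "p i \<in> verts G" if "i \<le> k" for i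
    proof (cases "i = k")
      case False
      then have "{p i, p (Suc i)} \<in> edges G"
        using step that by auto
      then show ?thesis
        using assms by (auto simp: tree_def simple_graph_def doubleton_eq_iff)
    qed (use p uv in simp)
    have "cycle_in G (map p [0..<Suc k])"
      unfolding cycle_in_def cycle_edges_map[OF zero_less_Suc]
    proof (intro conjI)
      have "inj_on p {0..<Suc k}"
        using inj by (intro linorder_inj_onI') auto
      then show "distinct (map p [0..<Suc k])"
        by (simp add: distinct_map del: upt_Suc)
      show "set (map p [0..<Suc k]) \<subseteq> verts G"
        using verts by auto
      show "{{p i, p (Suc i)} | i. Suc i < Suc k} \<union> {{p (Suc k - 1), p 0}} \<subseteq> edges G"
        using step p e uv by (auto simp: insert_commute)
    qed (use k in simp)
    then show False
      using assms by (auto simp: tree_def)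
  qed
  with uv show "\<exists>u v. e = {u, v} \<and> \<not> linked (edges G - {e}) u v" by blast
qed

text \<open>Walking round the cycle the long way joins the ends of the closing edge, which is then
  no bridge.\<close>

lemma forest_no_cycle:
  assumes "forest (edges G)"
  shows "\<not> cycle_in G vs"
proof
  assume cyc: "cycle_in G vs"
  define n where "n = length vs"
  define c where "c = (\<lambda>i. vs ! i)"
  have n: "n \<ge> 3" and inj: "\<And>i j. i < n \<Longrightarrow> j < n \<Longrightarrow> c i = c j \<longleftrightarrow> i = j"
    using cyc by (auto simp: cycle_in_def n_def c_def nth_eq_iff_index_eq)
  have "vs = map c [0..<n]"
    unfolding n_def c_def by (rule map_nth[symmetric])
  then have E: "{{c i, c (Suc i)} | i. Suc i < n} \<union> {{c (n - 1), c 0}} \<subseteq> edges G"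
    using cyc cycle_edges_map[of n c] n by (auto simp: cycle_in_def)
  let ?e = "{c (n - 1), c 0}"
  have "linked (edges G - {?e}) (c 0) (c i)" if "i < n" for i
    using that
  proof (induction i)
    case (Suc i)
    have "{c i, c (Suc i)} \<in> edges G"
      using E Suc.prems by blast
    \<comment> \<open>With two vertices the first edge would coincide with the closing edge;
      \<open>n \<ge> 3\<close> excludes this.\<close>
    moreover have "{c i, c (Suc i)} \<noteq> ?e"
    proof -
      have "c (Suc i) \<noteq> c 0" "i \<noteq> 0 \<Longrightarrow> c i \<noteq> c 0" "c (Suc 0) \<noteq> c (n - 1)"
        using Suc.prems n by (subst inj; simp)+
      then show ?thesis
        by (cases "i = 0") (auto simp: doubleton_eq_iff)
    qed
    ultimately show ?case
      using Suc by (meson DiffI Suc_lessD linked_edge linked_trans singletonD)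
  qed simp
  then have "linked (edges G - {?e}) (c (n - 1)) (c 0)"
    by (rule linked_sym) (use n in simp)
  then show False
    using forest_bridge[OF assms, of "c (n - 1)" "c 0"] E by auto
qed

section \<open>Exchanging an edge of a spanning tree\<close>

lemma exchange_forest:
  assumes "forest E" "e \<in> E" "\<not> linked (E - {e}) u v"
  shows "forest (insert {u, v} (E - {e}))"
  unfolding forest_def
proof
  fix g
  assume g: "g \<in> insert {u, v} (E - {e})"
  let ?f = "{u, v}"
  have f: "?f \<notin> E - {e}"
    using assms(3) linked_edge by metis
  show "\<exists>a b. g = {a, b} \<and> \<not> linked (insert ?f (E - {e}) - {g}) a b"
  proof (cases "g = ?f")
    case True
    then show ?thesis
      using assms(3) f by (intro exI[of _ u] exI[of _ v]) simp
  next
    case False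
    then have gE: "g \<in> E" "g \<noteq> e"
      using g by auto
    then obtain a b where ab: "g = {a, b}"
      using assms(1) by (meson forestE)
    \<comment> \<open>A detour around \<open>g\<close> must use the new edge; closed up with
      \<open>g\<close>, which survives in \<open>E - {e}\<close>, it would link \<open>u\<close> and
      \<open>v\<close> there.\<close>
    have "\<not> linked (insert ?f (E - {e}) - {g}) a b"
    proof
      assume l: "linked (insert ?f (E - {e}) - {g}) a b"
      let ?H = "E - {e} - {g}"
      have "insert ?f (E - {e}) - {g} = insert ?f ?H"
        using False by auto
      then have "linked ?H a b \<or> linked ?H a u \<and> linked ?H v b \<or> linked ?H a v \<and> linked ?H u b"
        using l linked_insert_edge by metis
      moreover have "\<not> linked ?H a b"
        using forest_bridge[OF assms(1), of a b] gE ab linked_mono[of ?H a b "E - {g}"] by blast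
      moreover have "linked (E - {e}) x y" if "linked ?H x y" for x y
        using that by (rule linked_mono) auto
      moreover have "linked (E - {e}) a b"
        using gE ab by (intro linked_edge) auto
      ultimately show False
        using assms(3) linked_trans_back[of "E - {e}" a _ b] linked_sym by metis
    qed
    with ab show ?thesis by blast
  qed
qed

text \<open>In \<open>E\<close> every walk from \<open>u\<close> to \<open>v\<close> passes through
  \<open>e\<close>, so the new edge closes a detour between the ends of \<open>e\<close>.\<close>

lemma exchange_linked:
  assumes "forest E" "e \<in> E" "\<not> linked (E - {e}) u v" "linked E u v" "linked E x y"
  shows "linked (insert {u, v} (E - {e})) x y"
proof -
  let ?E = "insert {u, v} (E - {e})"
  obtain p q where pq: "e = {p, q}"
    using assms by (meson forestE)
  have "linked (E - {e}) u p \<and> linked (E - {e}) q v \<or> linked (E - {e}) u q \<and> linked (E - {e}) p v"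
    using linked_remove_edge[of E u v p q] assms pq by auto
  moreover have "linked ?E u v"
    by (rule linked_edge) simp
  moreover have "linked ?E a b" if "linked (E - {e}) a b" for a b
    using that by (rule linked_mono) auto
  ultimately have pq_linked: "linked ?E p q"
    using linked_trans_back[of ?E u _ v] linked_sym by metis
  show ?thesis
    using assms(5)
  proof (induction rule: linked_induct)
    case (step y z)
    have "linked ?E y z"
    proof (cases "{y, z} = e")
      case True
      then show ?thesis
        using pq pq_linked linked_sym by (metis doubleton_eq_iff)
    qed (use step in \<open>auto intro: linked_edge\<close>)
    then show ?case
      using step linked_trans by metis
  qed simp
qed

text \<open>Swapping \<open>e\<close> for \<open>{u, v}\<close> yields another spanning tree, and
  maximality compares the two weights.\<close>

lemma max_weight_exchange:
  assumes max: "max_weight_spanning_tree K w T" and K: "simple_graph K" and fin: "finite (edges T)"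
    and e: "e \<in> edges T" and uv: "{u, v} \<in> edges K" and nl: "\<not> linked (edges T - {e}) u v"
  shows "w {u, v} \<le> w e"
proof -
  let ?T = "T\<lparr>edges := insert {u, v} (edges T - {e})\<rparr>"
  have T: "tree T" "verts T = verts K" "edges T \<subseteq> edges K"
    using max by (auto simp: max_weight_spanning_tree_def spanning_tree_def)
  have vs: "u \<in> verts T" "v \<in> verts T" "u \<noteq> v"
    using K uv T by (auto simp: simple_graph_def doubleton_eq_iff)
  have "tree ?T"
    unfolding tree_def
  proof (intro conjI)
    show "simple_graph ?T"
      using T vs by (auto simp: tree_def simple_graph_def)
    show "verts ?T \<noteq> {}"
      using T by (auto simp: tree_def)
    have "linked (edges T) x y" if "x \<in> verts T" "y \<in> verts T" for x y
      using T that by (auto simp: tree_def reachable_eq_linked)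
    then show "\<forall>x\<in>verts ?T. \<forall>y\<in>verts ?T. reachable ?T x y"
      using exchange_linked[OF tree_forest[OF T(1)] e nl] vs by (simp add: reachable_eq_linked)
    show "\<nexists>vs. cycle_in ?T vs"
      using forest_no_cycle[of ?T] exchange_forest[OF tree_forest[OF T(1)] e nl] by auto
  qed
  then have "spanning_tree K ?T"
    using T uv by (auto simp: spanning_tree_def)
  then have "sum w (edges ?T) \<le> sum w (edges T)"
    using max by (auto simp: max_weight_spanning_tree_def)
  moreover have "{u, v} \<notin> edges T - {e}"
    using nl linked_edge by metis
  ultimately show ?thesis
    using fin e sum.remove[of "edges T" e w] by simp
qed

section \<open>Clique trees of chordal graphs\<close>

lemma clique_extends_to_max_clique:
  assumes "finite (verts G)" "clique G Q"
  obtains M where "max_clique G M" "Q \<subseteq> M"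
proof -
  have "finite {M. clique G M \<and> Q \<subseteq> M}"
    by (rule finite_subset[of _ "Pow (verts G)"]) (use assms in \<open>auto simp: clique_def\<close>)
  moreover have "Q \<in> {M. clique G M \<and> Q \<subseteq> M}"
    using assms(2) by simp
  ultimately obtain M where M: "clique G M" "Q \<subseteq> M"
    and max: "\<forall>M' \<in> {M. clique G M \<and> Q \<subseteq> M}. M \<subseteq> M' \<longrightarrow> M = M'"
    by (rule finite_has_maximal2[THEN bexE]) auto
  have "max_clique G M"
    unfolding max_clique_def using M max by auto
  with M show thesis
    using that by blast
qed

text \<open>If \<open>s\<close> missed some \<open>p i\<close>, its nearest neighbours before and
  after \<open>p i\<close> would bound a stretch of the path that forms a chordless cycle with
  \<open>s\<close>.\<close>

lemma chordal_common_neighbour: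
  assumes G: "chordal G" "simple_graph G" and s: "s \<in> verts G"
    and p_edge: "\<And>i. i < k \<Longrightarrow> {p i, p (Suc i)} \<in> edges G"
    and p_s: "\<And>i. i \<le> k \<Longrightarrow> p i \<noteq> s"
    and p_inj: "\<And>i j. i < j \<Longrightarrow> j \<le> k \<Longrightarrow> p i \<noteq> p j"
    and p_induced: "\<And>i j. i < j \<Longrightarrow> j \<le> k \<Longrightarrow> {p i, p j} \<in> edges G \<Longrightarrow> j = Suc i"
    and ends: "{s, p 0} \<in> edges G" "{s, p k} \<in> edges G"
    and i: "i \<le> k"
  shows "{s, p i} \<in> edges G"
proof (rule ccontr)
  assume not: "{s, p i} \<notin> edges G"
  define a where "a = Max {j. j < i \<and> {s, p j} \<in> edges G}"
  define b where "b = (LEAST j. i < j \<and> {s, p j} \<in> edges G)"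
  have "0 < i" "i < k"
    using not ends i by (auto simp: le_less intro!: Nat.gr0I)
  have "a \<in> {j. j < i \<and> {s, p j} \<in> edges G}"
    unfolding a_def by (rule Max_in) (use \<open>0 < i\<close> ends in auto)
  then have a: "a < i" "{s, p a} \<in> edges G" by auto
  have a_max: "j \<le> a" if "j < i" "{s, p j} \<in> edges G" for j
    unfolding a_def by (rule Max_ge) (use that in auto)
  have b: "i < b" "{s, p b} \<in> edges G"
    using LeastI[of "\<lambda>j. i < j \<and> {s, p j} \<in> edges G" k] \<open>i < k\<close> ends by (auto simp: b_def)
  have b_min: "b \<le> j" if "i < j" "{s, p j} \<in> edges G" for j
    unfolding b_def by (rule Least_le) (use that in auto)
  have bk: "b \<le> k"
    using b_min \<open>i < k\<close> ends by auto
  \<comment> \<open>The cycle is \<open>s, p a, ..., p b\<close>; the index shift makes room for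
    \<open>s\<close>, and \<open>a < i < b\<close> gives at least four vertices.\<close>
  define c where "c = (\<lambda>m. if m = 0 then s else p (a + m - 1))"
  define n where "n = b - a + 2"
  let ?vs = "map c [0..<n]"
  have c_simps: "c 0 = s" "\<And>m. c (Suc m) = p (a + m)"
    by (auto simp: c_def)
  have n4: "n \<ge> 4"
    using a b by (simp add: n_def)
  have edge: "{c m, c (Suc m)} \<in> edges G" if "Suc m < n" for m
  proof (cases m)
    case (Suc m')
    then show ?thesis
      using p_edge[of "a + m'"] that bk by (auto simp: c_simps n_def)
  qed (use a in \<open>simp add: c_simps\<close>)
  have last: "c (n - 1) = p b"
    using a b by (auto simp: c_def n_def)
  have in_verts: "c m \<in> verts G" if "m < n" for m
  proof (cases "Suc m < n")
    case True
    then show ?thesis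
      using edge[of m] G(2) by (auto simp: simple_graph_def doubleton_eq_iff)
  next
    case False
    then have "m = n - 1"
      using that by simp
    then show ?thesis
      using last b(2) G(2) by (auto simp: simple_graph_def doubleton_eq_iff)
  qed
  have c_inj: "c l \<noteq> c m" if "l < m" "m < n" for l m
  proof -
    obtain m' where m': "m = Suc m'"
      using \<open>l < m\<close> by (cases m) auto
    moreover have "a + m' \<le> k"
      using that m' bk a b by (simp add: n_def)
    ultimately show ?thesis
      using that p_s[of "a + m'"] p_inj[of "a + (l - 1)" "a + m'"]
      by (cases l) (auto simp: c_simps)
  qed
  note cyc = cycle_edges_map[of n c]
  have "cycle_in G ?vs"
    unfolding cycle_in_def
  proof (intro conjI)
    have "inj_on c {0..<n}"
      using c_inj by (intro linorder_inj_onI') auto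
    then show "distinct ?vs"
      by (simp add: distinct_map)
    show "set ?vs \<subseteq> verts G"
      using in_verts by auto
    show "cycle_edges ?vs \<subseteq> edges G"
      using cyc edge last b(2) n4 c_simps(1) by (auto simp: insert_commute)
  qed (use n4 in simp)
  then have "has_chord G ?vs"
    using G(1) n4 by (auto simp: chordal_def)
  then obtain l m where lm: "l < n" "m < n" "c l \<noteq> c m" "{c l, c m} \<in> edges G"
      "{c l, c m} \<notin> cycle_edges ?vs"
    by (auto simp: has_chord_def)
  \<comment> \<open>A chord at \<open>s\<close> contradicts the choice of \<open>a\<close> and
    \<open>b\<close>; a chord between two path vertices contradicts that the path is
    induced.\<close>
  have no_chord: "{c l, c m} \<in> cycle_edges ?vs" if "l < m" "m < n" "{c l, c m} \<in> edges G" for l m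
  proof (cases l)
    case 0
    obtain m' where m': "m = Suc m'"
      using \<open>l < m\<close> by (cases m) auto
    then have e: "{s, p (a + m')} \<in> edges G"
      using that 0 by (simp add: c_simps)
    then have "a + m' \<noteq> i"
      using not by auto
    then have "a + m' \<le> a \<or> b \<le> a + m'"
      using e a_max b_min by (meson linorder_neqE_nat)
    then have "m = 1 \<or> m = n - 1"
      using that(2) m' a b by (auto simp: n_def)
    then show ?thesis
      using 0 cyc n4 by (auto simp: insert_commute)
  next
    case (Suc l')
    obtain m' where m': "m = Suc m'"
      using \<open>l < m\<close> by (cases m) auto
    have "a + m' = Suc (a + l')"
      using p_induced[of "a + l'" "a + m'"] that Suc m' bk a b by (auto simp: c_simps n_def)
    then have "m = Suc l"
      using Suc m' by simp
    then show ?thesis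
      using cyc n4 that by auto
  qed
  show False
    using lm no_chord[of l m] no_chord[of m l] by (metis insert_commute linorder_neqE_nat)
qed

text \<open>
  By chordality, every element of \<open>S\<close> is adjacent to all of a shortest path from \<open>x\<close> to \<open>y\<close>
  outside \<open>S\<close>; each edge of this path together with \<open>S\<close> lies in a max-clique of the chain.
\<close>

lemma chordal_max_clique_chain:
  assumes G: "chordal G" "simple_graph G" "finite (verts G)"
    and Q: "max_clique G Q" and Q': "max_clique G Q'" and S: "S \<subseteq> Q \<inter> Q'"
    and x: "x \<in> Q - S" and y: "y \<in> Q' - S"
    and xy: "linked {e \<in> edges G. e \<inter> S = {}} x y"
  shows "(\<lambda>P R. max_clique G P \<and> max_clique G R \<and> card S < card (P \<inter> R))\<^sup>*\<^sup>* Q Q'"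
proof -
  let ?R = "\<lambda>P R. max_clique G P \<and> max_clique G R \<and> card S < card (P \<inter> R)"
  obtain p k where p: "p 0 = x" "p k = y"
    and step: "\<And>i. i < k \<Longrightarrow> {p i, p (Suc i)} \<in> {e \<in> edges G. e \<inter> S = {}}"
    and inj: "\<And>i j. i < j \<Longrightarrow> j \<le> k \<Longrightarrow> p i \<noteq> p j"
    and induced: "\<And>i j. i < j \<Longrightarrow> j \<le> k \<Longrightarrow> {p i, p j} \<in> {e \<in> edges G. e \<inter> S = {}} \<Longrightarrow> j = Suc i"
    by (rule relpowp_least_path[OF xy[unfolded linked_def]]) (rule that)
  have clq: "Q \<subseteq> verts G" "Q' \<subseteq> verts G"
    "\<And>u v. u \<in> Q \<Longrightarrow> v \<in> Q \<Longrightarrow> u \<noteq> v \<Longrightarrow> {u, v} \<in> edges G"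
    "\<And>u v. u \<in> Q' \<Longrightarrow> v \<in> Q' \<Longrightarrow> u \<noteq> v \<Longrightarrow> {u, v} \<in> edges G"
    using Q Q' by (auto simp: max_clique_def clique_def)
  have fin: "finite P" if "max_clique G P" for P
    using that G(3) by (auto simp: max_clique_def clique_def intro: finite_subset)
  have fin_S: "finite S"
    using S fin[OF Q] by (auto intro: finite_subset)
  have p_S: "p i \<notin> S" if "i \<le> k" for i
    using that step[of i] p(2) y by (cases "i = k") auto
  have adj: "{s, p i} \<in> edges G" if "s \<in> S" "i \<le> k" for s i
  proof (rule chordal_common_neighbour[OF G(1,2)])
    show "s \<in> verts G"
      using that S clq by auto
    show "{s, p 0} \<in> edges G" "{s, p k} \<in> edges G"
      using that S x y p clq(3)[of s x] clq(4)[of s y] by auto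
    show "j = Suc i" if "i < j" "j \<le> k" "{p i, p j} \<in> edges G" for i j
      using induced[OF that(1,2)] that p_S[of i] p_S[of j] by auto
  qed (use step inj p_S that in auto)
  have link: "?R P P'" if "max_clique G P" "max_clique G P'" "insert z S \<subseteq> P \<inter> P'" "z \<notin> S"
    for P P' z
  proof -
    have "card (insert z S) \<le> card (P \<inter> P')"
      using that fin[of P] by (intro card_mono) auto
    then show ?thesis
      using that fin_S by simp
  qed
  \<comment> \<open>The claim ranges over all max-cliques through \<open>p m\<close> and
    \<open>S\<close>, so that \<open>Q'\<close> itself can be taken at the end of the path.\<close>
  have "?R\<^sup>*\<^sup>* Q P" if "max_clique G P" "insert (p m) S \<subseteq> P" "m \<le> k" for m P
    using that
  proof (induction m arbitrary: P)
    case 0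
    then show ?case
      using link[OF Q, of P x] p x S by auto
  next
    case (Suc m)
    have "clique G (insert (p m) (insert (p (Suc m)) S))"
      unfolding clique_def
    proof (intro conjI ballI impI)
      show "insert (p m) (insert (p (Suc m)) S) \<subseteq> verts G"
        using step[of m] Suc.prems S clq(1) G(2)
        by (auto simp: simple_graph_def doubleton_eq_iff)
      show "{u, v} \<in> edges G"
        if "u \<in> insert (p m) (insert (p (Suc m)) S)" "v \<in> insert (p m) (insert (p (Suc m)) S)"
          "u \<noteq> v" for u v
        using that step[of m] Suc.prems adj[of _ m] adj[of _ "Suc m"] clq(3)[of u v] S
        by (auto simp: insert_commute)
    qed
    then obtain M where M: "max_clique G M" "insert (p m) (insert (p (Suc m)) S) \<subseteq> M"
      using clique_extends_to_max_clique[OF G(3)] by blast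
    have "?R\<^sup>*\<^sup>* Q M"
      using Suc M by auto
    moreover have "?R M P"
      using link[OF M(1) Suc.prems(1), of "p (Suc m)"] M(2) Suc.prems p_S by auto
    ultimately show ?case
      by (rule rtranclp.rtrancl_into_rtrancl)
  qed
  from this[OF Q', of k] show ?thesis
    using p y S by auto
qed

text \<open>
  Among the tree edges that violate the clique tree property take one of minimal weight, between
  max-cliques with intersection \<open>S\<close>. Every edge on the tree path from \<open>P\<close> to \<open>R\<close> has intersection
  equal to \<open>S\<close> or not contained in \<open>S\<close>. The max-cliques just before the first and just after the
  last edge with intersection \<open>S\<close> are therefore connected outside \<open>S\<close>, through \<open>h\<close>. Some link of
  the chain of max-cliques between them crosses that first edge, and exchanging the two gains weight.
\<close>

lemma max_weight_spanning_tree_is_clique_tree: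
  fixes G :: "'v sgraph" and K T :: "'v set sgraph"
  assumes G: "chordal G" "simple_graph G" "finite (verts G)"
    and K: "verts K = {Q. max_clique G Q}"
      "edges K = {{Q, Q'} | Q Q'. max_clique G Q \<and> max_clique G Q' \<and> Q \<noteq> Q' \<and> Q \<inter> Q' \<noteq> {}}"
    and T: "max_weight_spanning_tree K (\<lambda>e. card (\<Inter>e)) T"
    and PR: "max_clique G P" "max_clique G R" "h \<in> P \<inter> R"
  shows "linked {f \<in> edges T. h \<in> \<Inter>f} P R"
proof -
  have tree: "tree T" "verts T = {Q. max_clique G Q}" "edges T \<subseteq> edges K"
    using T K by (auto simp: max_weight_spanning_tree_def spanning_tree_def)
  note forest = tree_forest[OF tree(1)]
  have fin: "finite Q" if "max_clique G Q" for Q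
    using that G(3) by (auto simp: max_clique_def clique_def intro: finite_subset)
  have "finite {Q. max_clique G Q}"
    by (rule finite_subset[of _ "Pow (verts G)"])
      (use G(3) in \<open>auto simp: max_clique_def clique_def\<close>)
  moreover have "edges T \<subseteq> Pow {Q. max_clique G Q}"
    using tree(3) unfolding K(2) by blast
  ultimately have fin_T: "finite (edges T)"
    by (meson finite_Pow_iff finite_subset)
  have simple_K: "simple_graph K"
    unfolding simple_graph_def K by blast
  have conn: "linked (edges T) Q Q'" if "max_clique G Q" "max_clique G Q'" for Q Q'
    using tree that by (auto simp: tree_def reachable_eq_linked)
  have T_edge: "max_clique G Q \<and> max_clique G Q' \<and> Q \<noteq> Q'" if "{Q, Q'} \<in> edges T" for Q Q'
    using that tree(3) unfolding K(2) by (auto simp: doubleton_eq_iff)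
  define bad where "bad f \<longleftrightarrow> f \<in> edges T \<and> (\<exists>P R h. max_clique G P \<and> max_clique G R \<and> h \<in> P \<inter> R
      \<and> h \<notin> \<Inter>f \<and> \<not> linked (edges T - {f}) P R)" for f
  have no_bad: "\<not> bad f0" for f0
  proof
    assume "bad f0"
    then obtain f where f: "bad f" and f_min: "\<And>g. bad g \<Longrightarrow> card (\<Inter>f) \<le> card (\<Inter>g)"
      using ex_has_least_nat[of bad f0 "\<lambda>f. card (\<Inter>f)"] by blast
    define S where "S = \<Inter>f"
    obtain P R h where PRh: "max_clique G P" "max_clique G R" "h \<in> P" "h \<in> R" "h \<notin> S"
        "\<not> linked (edges T - {f}) P R" and fT: "f \<in> edges T"
      using f unfolding bad_def S_def by blast
    obtain F where F: "F \<subseteq> edges T" "linked F P R"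
      and sep: "\<And>g. g \<in> F \<Longrightarrow> \<not> linked (edges T - {g}) P R"
      using forest_path[OF forest fin_T conn[OF PRh(1,2)]] by blast
    define F0 where "F0 = {g. \<Inter>g = S}"
    have not_PR: "\<not> linked (F - F0) P R"
      using PRh(6) linked_mono[of "F - F0" P R "edges T - {f}"] F(1) by (auto simp: F0_def S_def)
    obtain Q1 Q2 where fQ: "f = {Q1, Q2}"
      using forest fT by (meson forestE)
    then have fin_S: "finite S"
      using T_edge[of Q1 Q2] fT fin by (auto simp: S_def)
    \<comment> \<open>An edge of the path with intersection inside \<open>S\<close> misses
      \<open>h\<close> and is therefore bad as well; minimality of \<open>card S\<close> forces
      equality, which puts the edge into \<open>F0\<close>.\<close>
    have escape: "\<not> \<Inter>g \<subseteq> S" if g: "g \<in> F - F0" for g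
    proof
      assume sub: "\<Inter>g \<subseteq> S"
      then have "h \<notin> \<Inter>g"
        using PRh(5) by blast
      then have "bad g"
        unfolding bad_def using g F(1) sep[of g] PRh by blast
      then have "card S \<le> card (\<Inter>g)"
        using f_min by (simp add: S_def)
      then have "\<Inter>g = S"
        using card_seteq[OF fin_S sub] by simp
      then show False
        using g by (simp add: F0_def)
    qed
    let ?L = "linked {e \<in> edges G. e \<inter> S = {}}"
    have outside: "max_clique G U \<and> (\<forall>x \<in> U - S. ?L h x)"
      if "linked (F - F0) P' U" "max_clique G P'" "h \<in> P'" for P' U
      using that(1)
    proof (induction rule: linked_induct)
      case refl
      have "?L h x" if "x \<in> P' - S" for x
      proof (cases "x = h")
        case False
        then have "{h, x} \<in> edges G"
          using that \<open>h \<in> P'\<close> \<open>max_clique G P'\<close> by (auto simp: max_clique_def clique_def)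
        then show ?thesis
          using that PRh(5) by (intro linked_edge) auto
      qed simp
      then show ?case
        using that(2) by blast
    next
      case (step U V)
      obtain z where z: "z \<in> U" "z \<in> V" "z \<notin> S"
        using escape[OF step.hyps(2)] by auto
      have V: "max_clique G V"
        using T_edge step.hyps(2) F(1) by blast
      have "?L h x" if "x \<in> V - S" for x
      proof (cases "x = z")
        case False
        then have "{z, x} \<in> edges G"
          using that z V by (auto simp: max_clique_def clique_def)
        then have "?L z x"
          using that z by (intro linked_edge) auto
        moreover have "?L h z"
          using step.IH z by blast
        ultimately show ?thesis
          by (rule linked_trans[rotated])
      qed (use step.IH z in auto)
      with V show ?case by blast
    qed
    obtain U V where UV: "linked (F - F0) P U" "{U, V} \<in> F" "{U, V} \<in> F0"
      using linked_leaves_set[OF F(2) not_PR] by blast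
    obtain U' V' where UV': "linked (F - F0) R U'" "{U', V'} \<in> F" "{U', V'} \<in> F0"
      using linked_leaves_set[OF linked_sym[OF F(2)], of F0] not_PR linked_sym[of "F - F0" R P]
      by blast
    have sub: "S \<subseteq> U" "S \<subseteq> U'" and S_eq: "\<Inter>{U, V} = S" "\<Inter>{U', V'} = S"
      using UV(3) UV'(3) by (auto simp: F0_def)
    \<comment> \<open>A max-clique inside \<open>S\<close> would be contained in its neighbour in
      the tree, hence equal to it.\<close>
    have proper: "\<exists>x. x \<in> U - S" if "{U, V} \<in> F" "\<Inter>{U, V} = S" for U V
    proof (rule ccontr)
      assume "\<nexists>x. x \<in> U - S"
      then have "U \<subseteq> V"
        using that(2) by auto
      then show False
        using T_edge[of U V] that(1) F(1) by (auto simp: max_clique_def)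
    qed
    obtain x where x: "x \<in> U - S"
      using proper[OF UV(2) S_eq(1)] by blast
    obtain y where y: "y \<in> U' - S"
      using proper[OF UV'(2) S_eq(2)] by blast
    have max: "max_clique G U" "max_clique G U'" and hxy: "?L h x" "?L h y"
      using outside[OF UV(1) PRh(1,3)] outside[OF UV'(1) PRh(2,4)] x y by auto
    have "?L x y"
      by (rule linked_trans[OF linked_sym[OF hxy(1)] hxy(2)])
    then have chain: "(\<lambda>P R. max_clique G P \<and> max_clique G R \<and> card S < card (P \<inter> R))\<^sup>*\<^sup>* U U'"
      using chordal_max_clique_chain[OF G max _ x y] sub by blast
    let ?e = "{U, V}"
    have "linked (edges T - {?e}) U U'"
      using chain
    proof (induction rule: rtranclp_induct)
      case (step Y Z)
      have "linked (edges T - {?e}) Y Z"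
      proof (rule ccontr)
        assume nl: "\<not> linked (edges T - {?e}) Y Z"
        then have "Y \<noteq> Z"
          using linked_refl by metis
        moreover have "Y \<inter> Z \<noteq> {}"
          using step.hyps(2) by force
        ultimately have "{Y, Z} \<in> edges K"
          using step.hyps(2) unfolding K(2) by blast
        then have "card (\<Inter>{Y, Z}) \<le> card (\<Inter>?e)"
          using max_weight_exchange[OF T simple_K fin_T _ _ nl] UV(2) F(1) by blast
        then show False
          using step.hyps(2) unfolding S_eq(1) by simp
      qed
      then show ?case
        by (rule linked_trans[OF step.IH])
    qed simp
    moreover have mono: "linked (edges T - {?e}) a b" if "linked (F - F0) a b" for a b
      using that by (rule linked_mono) (use F(1) UV(3) in auto)
    ultimately have "linked (edges T - {?e}) P R"
      using linked_trans[OF linked_trans[OF mono[OF UV(1)]] linked_sym[OF mono[OF UV'(1)]]] by simp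
    then show False
      using sep[OF UV(2)] by blast
  qed
  obtain F where F: "F \<subseteq> edges T" "linked F P R"
    and sep: "\<And>g. g \<in> F \<Longrightarrow> \<not> linked (edges T - {g}) P R"
    using forest_path[OF forest fin_T conn[OF PR(1,2)]] by blast
  have "h \<in> \<Inter>g" if "g \<in> F" for g
    using no_bad[of g] sep[OF that] F(1) that PR unfolding bad_def by blast
  then show ?thesis
    by (intro linked_mono[OF F(2)]) (use F(1) in auto)
qed

section \<open>Entropy vectors and the line graph\<close>

lemma entropy_empty [simp]: "entropy N S {} = 0"
  by (simp add: entropy_def)

lemma entropy_compl: "X \<subseteq> {0..N} \<Longrightarrow> entropy N S ({0..N} - X) = entropy N S X"
  by (auto simp: entropy_def double_diff)

lemma entropy_subadditive:
  assumes "SA N S" "X \<subseteq> {0..N}" "Y \<subseteq> {0..N}" "X \<inter> Y = {}"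
  shows "entropy N S (X \<union> Y) \<le> entropy N S X + entropy N S Y"
proof (cases "X = {} \<or> Y = {}")
  case False
  then have "mutual_info N S X Y \<ge> 0"
    using assms unfolding SA_def by blast
  then show ?thesis
    by (simp add: mutual_info_def)
qed auto

text \<open>\<open>X\<close> and its complement have the same entropy and their union has entropy
  zero, so subadditivity bounds twice the entropy below by zero.\<close>

lemma entropy_nonneg:
  assumes "SA N S" "X \<subseteq> {0..N}"
  shows "entropy N S X \<ge> 0"
proof -
  have "entropy N S (X \<union> ({0..N} - X)) \<le> entropy N S X + entropy N S ({0..N} - X)"
    using assms by (intro entropy_subadditive) auto
  moreover have "X \<union> ({0..N} - X) = {0..N}"
    using assms by auto
  ultimately show ?thesis
    using entropy_compl[OF assms(2)] by (simp add: entropy_def)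
qed

lemma mutual_info_mono:
  assumes SA: "SA N S" and SSA: "SSA N S"
    and sub: "X \<subseteq> {0..N}" "Y \<subseteq> {0..N}" "Z \<subseteq> {0..N}"
    and disj: "X \<inter> Y = {}" "X \<inter> Z = {}" "Y \<inter> Z = {}"
  shows "mutual_info N S X Y \<le> mutual_info N S X (Y \<union> Z)"
proof -
  consider "X = {}" | "Z = {}" | "Y = {}" | "X \<noteq> {}" "Y \<noteq> {}" "Z \<noteq> {}" by blast
  then show ?thesis
  proof cases
    case 3
    then show ?thesis
      using entropy_subadditive[OF SA, of X Z] sub disj by (simp add: mutual_info_def)
  next
    case 4
    then show ?thesis
      using SSA sub disj by (simp add: SSA_def)
  qed (simp_all add: mutual_info_def)
qed

text \<open>This is SSA with the remaining parties \<open>?D\<close> added to \<open>A\<close>: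
  taking complements turns the enlarged sets into \<open>B \<union> C\<close> and
  \<open>B\<close>.\<close>

lemma entropy_weak_mono:
  assumes SA: "SA N S" and SSA: "SSA N S"
    and sub: "A \<subseteq> {0..N}" "B \<subseteq> {0..N}" "C \<subseteq> {0..N}"
    and disj: "A \<inter> B = {}" "A \<inter> C = {}" "B \<inter> C = {}"
  shows "entropy N S A + entropy N S B \<le> entropy N S (A \<union> C) + entropy N S (B \<union> C)"
proof -
  let ?D = "{0..N} - (A \<union> B \<union> C)"
  have "mutual_info N S C A \<le> mutual_info N S C (A \<union> ?D)"
    using assms by (intro mutual_info_mono) auto
  moreover have "A \<union> ?D = {0..N} - (B \<union> C)" "C \<union> (A \<union> ?D) = {0..N} - B"
    using sub disj by auto
  moreover have "entropy N S ({0..N} - (B \<union> C)) = entropy N S (B \<union> C)"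
    "entropy N S ({0..N} - B) = entropy N S B"
    using sub by (auto intro!: entropy_compl)
  ultimately show ?thesis
    by (simp add: mutual_info_def Un_commute)
qed

lemma entropy_sym_diff:
  assumes "SA N S" "SSA N S" "X \<subseteq> {0..N}" "Y \<subseteq> {0..N}"
  shows "entropy N S ((X - Y) \<union> (Y - X)) \<le> entropy N S X + entropy N S Y"
proof -
  have "entropy N S ((X - Y) \<union> (Y - X)) \<le> entropy N S (X - Y) + entropy N S (Y - X)"
    using assms by (intro entropy_subadditive) auto
  also have "\<dots> \<le> entropy N S ((X - Y) \<union> (X \<inter> Y)) + entropy N S ((Y - X) \<union> (X \<inter> Y))"
    using assms by (intro entropy_weak_mono) auto
  also have "(X - Y) \<union> (X \<inter> Y) = X"
    by auto
  also have "(Y - X) \<union> (X \<inter> Y) = Y"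
    by auto
  finally show ?thesis .
qed

text \<open>The parties covered an odd number of times form the iterated symmetric difference of the
  sets \<open>Y e\<close>; counting avoids an order on \<open>F\<close>.\<close>

lemma entropy_odd_cover:
  assumes "SA N S" "SSA N S" "finite F" "\<And>e. e \<in> F \<Longrightarrow> Y e \<subseteq> {0..N}"
  shows "entropy N S {l \<in> {0..N}. odd (card {e \<in> F. l \<in> Y e})} \<le> (\<Sum>e\<in>F. entropy N S (Y e))"
  using assms(3,4)
proof (induction F rule: finite_induct)
  case (insert f F)
  let ?X = "\<lambda>F. {l \<in> {0..N}. odd (card {e \<in> F. l \<in> Y e})}"
  have Yf: "Y f \<subseteq> {0..N}"
    using insert.prems by blast
  have "{e \<in> insert f F. l \<in> Y e} = (if l \<in> Y f then insert f {e \<in> F. l \<in> Y e} else {e \<in> F. l \<in> Y e})"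
    for l
    by auto
  then have "odd (card {e \<in> insert f F. l \<in> Y e}) \<longleftrightarrow> (l \<in> Y f) \<noteq> odd (card {e \<in> F. l \<in> Y e})" for l
    using insert.hyps by simp
  then have "?X (insert f F) = (?X F - Y f) \<union> (Y f - ?X F)"
    using Yf by auto
  then have "entropy N S (?X (insert f F)) \<le> entropy N S (?X F) + entropy N S (Y f)"
    using entropy_sym_diff[OF assms(1,2) _ Yf, of "?X F"] by (simp add: subset_iff)
  also have "\<dots> \<le> (\<Sum>e\<in>F. entropy N S (Y e)) + entropy N S (Y f)"
    using insert.IH insert.prems by simp
  finally show ?case
    using insert.hyps by simp
qed simp

text \<open>A set of at least two parties that is no hyperedge has a bipartition of vanishing mutual
  information. As an induction rule this serves both the construction of cuts and the
  superadditivity of entropy.\<close>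

lemma hyperedge_induct [consumes 2, case_names singleton hyperedge split]:
  assumes "X \<subseteq> {0..N}" "X \<noteq> {}"
    and singleton: "\<And>l. l \<le> N \<Longrightarrow> P {l}"
    and hyperedge: "\<And>X. X \<in> hyperedges N S \<Longrightarrow> P X"
    and split: "\<And>Y Z. Y \<union> Z \<subseteq> {0..N} \<Longrightarrow> Y \<noteq> {} \<Longrightarrow> Z \<noteq> {} \<Longrightarrow> Y \<inter> Z = {}
      \<Longrightarrow> entropy N S (Y \<union> Z) = entropy N S Y + entropy N S Z \<Longrightarrow> P Y \<Longrightarrow> P Z \<Longrightarrow> P (Y \<union> Z)"
  shows "P X"
  using assms(1,2)
proof (induction "card X" arbitrary: X rule: less_induct)
  case less
  have fin: "finite X"
    using less.prems by (auto intro: finite_subset)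
  then have "card X > 0"
    using less.prems by (simp add: card_gt_0_iff)
  then consider "card X = 1" | "X \<in> hyperedges N S" | "card X \<ge> 2" "X \<notin> hyperedges N S"
    by linarith
  then show ?case
  proof cases
    case 1
    then show ?thesis
      using singleton less.prems by (auto simp: card_1_singleton_iff)
  next
    case 2
    then show ?thesis
      by (rule hyperedge)
  next
    case 3
    then obtain Y Z where YZ: "Y \<noteq> {}" "Z \<noteq> {}" "Y \<inter> Z = {}" "X = Y \<union> Z"
        "(Y, Z) \<in> vanishing_MI N S"
      using less.prems by (auto simp: hyperedges_def positive_beta_set_def)
    have "Y \<subset> X" "Z \<subset> X"
      using YZ by auto
    then have "card Y < card X" "card Z < card X"
      using psubset_card_mono[OF fin] by auto
    then have "P Y" "P Z"
      using less YZ by auto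
    then show ?thesis
      using split[of Y Z] YZ less.prems by (auto simp: vanishing_MI_def mutual_info_def)
  qed
qed

text \<open>When \<open>W\<close> splits, its entropy splits exactly, while each term on the left is
  only subadditive. \<open>V\<close> stays fixed as \<open>W\<close> shrinks, so the hypotheses on
  hyperedges survive the induction.\<close>

lemma entropy_superadditive:
  assumes SA: "SA N S" and fin: "finite I"
    and sub: "W \<subseteq> V" "V \<subseteq> {0..N}"
    and disj: "\<And>i j. i \<in> I \<Longrightarrow> j \<in> I \<Longrightarrow> i \<noteq> j \<Longrightarrow> B i \<inter> B j \<inter> V = {}"
    and uncut: "\<And>Z i. Z \<in> hyperedges N S \<Longrightarrow> Z \<subseteq> V \<Longrightarrow> i \<in> I \<Longrightarrow> B i \<inter> Z \<noteq> {} \<Longrightarrow> Z \<subseteq> B i"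
  shows "(\<Sum>i\<in>I. entropy N S (B i \<inter> W)) \<le> entropy N S W"
proof (cases "W = {}")
  case False
  \<comment> \<open>An uncut set meets at most one \<open>B i\<close> and then lies inside it; all
    other terms vanish.\<close>
  have base: "(\<Sum>i\<in>I. entropy N S (B i \<inter> Z)) \<le> entropy N S Z"
    if Z: "Z \<subseteq> V" "Z \<noteq> {}" and uncut: "\<And>i. i \<in> I \<Longrightarrow> B i \<inter> Z \<noteq> {} \<Longrightarrow> Z \<subseteq> B i" for Z
  proof (cases "\<exists>i\<in>I. B i \<inter> Z \<noteq> {}")
    case True
    then obtain i where i: "i \<in> I" "Z \<subseteq> B i"
      using uncut by auto
    have "B j \<inter> Z = {}" if "j \<in> I - {i}" for j
      using disj[of i j] that i Z by auto
    then have "(\<Sum>j\<in>I - {i}. entropy N S (B j \<inter> Z)) = 0"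
      by (intro sum.neutral) auto
    then show ?thesis
      using i by (simp add: sum.remove[OF fin i(1)] Int_absorb1)
  next
    case False
    then have "(\<Sum>i\<in>I. entropy N S (B i \<inter> Z)) = 0"
      by (intro sum.neutral) auto
    then show ?thesis
      using entropy_nonneg[OF SA, of Z] Z sub by auto
  qed
  have "W \<subseteq> {0..N}"
    using sub by auto
  then have "W \<subseteq> V \<longrightarrow> (\<Sum>i\<in>I. entropy N S (B i \<inter> W)) \<le> entropy N S W"
    using False
  proof (induction W rule: hyperedge_induct[where S = S])
    case (singleton l)
    then show ?case
      using base[of "{l}"] by auto
  next
    case (hyperedge Z)
    then have "Z \<noteq> {}"
      by (auto simp: hyperedges_def)
    then show ?case
      using base[of Z] uncut[OF hyperedge] by auto
  next
    case (split Y Z)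
    show ?case
    proof
      assume YZ: "Y \<union> Z \<subseteq> V"
      have "entropy N S (B i \<inter> (Y \<union> Z)) \<le> entropy N S (B i \<inter> Y) + entropy N S (B i \<inter> Z)" for i
        unfolding Int_Un_distrib using split by (intro entropy_subadditive[OF SA]) auto
      then have "(\<Sum>i\<in>I. entropy N S (B i \<inter> (Y \<union> Z)))
          \<le> (\<Sum>i\<in>I. entropy N S (B i \<inter> Y)) + (\<Sum>i\<in>I. entropy N S (B i \<inter> Z))"
        unfolding sum.distrib[symmetric] by (intro sum_mono)
      also have "\<dots> \<le> entropy N S (Y \<union> Z)"
        using split YZ by simp
      finally show "(\<Sum>i\<in>I. entropy N S (B i \<inter> (Y \<union> Z))) \<le> entropy N S (Y \<union> Z)" .
    qed
  qed
  then show ?thesis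
    using sub by blast
qed simp

section \<open>Cliques of hyperedges\<close>

lemma hyperedge_nonempty: "h \<in> hyperedges N S \<Longrightarrow> h \<noteq> {}"
  by (auto simp: hyperedges_def)

lemma line_graph_simple: "simple_graph (line_graph N S)"
  unfolding simple_graph_def line_graph_def by auto

lemma finite_hyperedges: "finite (hyperedges N S)"
  by (rule finite_subset[of _ "Pow {0..N}"]) (auto simp: hyperedges_def)

text \<open>The diagonal case \<open>X = Y\<close> can be included because hyperedges are
  non-empty.\<close>

lemma clique_line_graph_iff:
  "clique (line_graph N S) Q \<longleftrightarrow> Q \<subseteq> hyperedges N S \<and> (\<forall>X\<in>Q. \<forall>Y\<in>Q. X \<inter> Y \<noteq> {})"
proof -
  have edge: "(X \<noteq> Y \<longrightarrow> {X, Y} \<in> edges (line_graph N S)) \<longleftrightarrow> X \<inter> Y \<noteq> {}"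
    if "X \<in> hyperedges N S" "Y \<in> hyperedges N S" for X Y
  proof (cases "X = Y")
    case True
    then show ?thesis
      using that hyperedge_nonempty by auto
  next
    case False
    then show ?thesis
      using that by (auto simp: line_graph_def doubleton_eq_iff)
  qed
  have verts: "verts (line_graph N S) = hyperedges N S"
    by (simp add: line_graph_def)
  show ?thesis
    unfolding clique_def verts using edge by (meson subsetD)
qed

text \<open>
  Two such max-cliques would contain disjoint hyperedges \<open>X\<close> and \<open>Y\<close> that meet every hyperedge
  through \<open>l\<close>, so that \<open>l\<close> is uncorrelated with the rest of the complement of each.
\<close>

lemma max_clique_through_party_unique:
  assumes "N \<ge> 1" and irr: "irreducible_entropy N S" and l: "l \<le> N"
    and Q: "max_clique (line_graph N S) Q" "party_clique N S l \<subseteq> Q"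
    and Q': "max_clique (line_graph N S) Q'" "party_clique N S l \<subseteq> Q'"
  shows "Q = Q'"
proof (rule ccontr)
  assume "Q \<noteq> Q'"
  have SA: "SA N S" and SSA: "SSA N S"
    using irr by (auto simp: irreducible_entropy_def)
  have clq: "Q \<subseteq> hyperedges N S" "Q' \<subseteq> hyperedges N S"
      "\<And>X Y. X \<in> Q \<Longrightarrow> Y \<in> Q \<Longrightarrow> X \<inter> Y \<noteq> {}" "\<And>X Y. X \<in> Q' \<Longrightarrow> Y \<in> Q' \<Longrightarrow> X \<inter> Y \<noteq> {}"
    using Q(1) Q'(1) by (auto simp: max_clique_def clique_line_graph_iff)
  obtain X where X: "X \<in> Q" "X \<notin> Q'"
    using Q(1) Q'(1) \<open>Q \<noteq> Q'\<close> unfolding max_clique_def by blast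
  have "\<not> clique (line_graph N S) (insert X Q')"
    using Q'(1) X by (auto simp: max_clique_def)
  then obtain Y where Y: "Y \<in> Q'" "X \<inter> Y = {}"
    using X clq hyperedge_nonempty[of X N S]
    unfolding clique_line_graph_iff by (auto simp: Int_commute)
  have sub: "X \<subseteq> {0..N}" "Y \<subseteq> {0..N}"
    using X Y clq by (auto simp: hyperedges_def)
  have lX: "l \<notin> X" and lY: "l \<notin> Y"
    using X Y Q(2) Q'(2) clq unfolding party_clique_def by blast+
  \<comment> \<open>No hyperedge avoiding \<open>Z\<close> contains \<open>l\<close>, so
    \<open>{l}\<close> and its complement are two blocks that cut none of them.\<close>
  have split: "entropy N S {l} + entropy N S ({0..N} - Z - {l}) \<le> entropy N S ({0..N} - Z)"
    if Z: "l \<notin> Z" "\<And>h. h \<in> party_clique N S l \<Longrightarrow> h \<inter> Z \<noteq> {}" for Z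
  proof -
    let ?V = "{0..N} - Z"
    let ?B = "\<lambda>b. if b then {l} else - {l}"
    have "(\<Sum>b\<in>UNIV. entropy N S (?B b \<inter> ?V)) \<le> entropy N S ?V"
    proof (rule entropy_superadditive[OF SA _ subset_refl])
      show "h \<subseteq> ?B b" if "h \<in> hyperedges N S" "h \<subseteq> ?V" "?B b \<inter> h \<noteq> {}" for h b
        using that Z(2)[of h] by (cases b) (auto simp: party_clique_def)
    qed auto
    moreover have "{l} \<inter> ?V = {l}" "- {l} \<inter> ?V = ?V - {l}"
      using l Z by auto
    ultimately show ?thesis
      by (simp add: UNIV_bool)
  qed
  have lN: "{l} \<subseteq> {0..N}"
    using l by auto
  \<comment> \<open>SSA enlarges \<open>Y\<close> to everything outside \<open>X\<close> except
    \<open>l\<close>, where \<open>split\<close> for \<open>X\<close> bounds the mutual information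
    by zero.\<close>
  have "mutual_info N S {l} Y \<le> mutual_info N S {l} (Y \<union> ({0..N} - X - {l} - Y))"
    using sub lN lY by (intro mutual_info_mono[OF SA SSA]) auto
  also have "Y \<union> ({0..N} - X - {l} - Y) = {0..N} - X - {l}"
    using sub lY Y by auto
  also have "mutual_info N S {l} \<dots> \<le> 0"
  proof -
    have "{l} \<union> ({0..N} - X - {l}) = {0..N} - X"
      using lX lN by auto
    moreover have "h \<inter> X \<noteq> {}" if "h \<in> party_clique N S l" for h
      using that Q(2) X clq by blast
    ultimately show ?thesis
      using split[OF lX] by (simp add: mutual_info_def)
  qed
  finally have "entropy N S {l} + entropy N S Y \<le> entropy N S (insert l Y)"
    by (simp add: mutual_info_def)
  moreover have "entropy N S {l} + entropy N S (insert l Y) \<le> entropy N S Y"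
  proof -
    have "{0..N} - Y - {l} = {0..N} - insert l Y"
      by auto
    moreover have "h \<inter> Y \<noteq> {}" if "h \<in> party_clique N S l" for h
      using that Q'(2) Y clq by blast
    ultimately show ?thesis
      using split[OF lY] entropy_compl[of Y N S] entropy_compl[of "insert l Y" N S] sub lN by simp
  qed
  \<comment> \<open>Adding the two inequalities cancels the terms with \<open>Y\<close> and leaves
    twice the entropy of \<open>{l}\<close> at most zero.\<close>
  ultimately have "entropy N S {l} = 0"
    using entropy_nonneg[OF SA lN] by simp
  moreover have "entropy N S {l} \<noteq> 0"
  proof -
    have "{l} \<noteq> {0..N}"
    proof
      assume "{l} = {0..N}"
      then have "card {l} = card {0..N}" by simp
      then show False
        using \<open>N \<ge> 1\<close> by simp
    qed
    \<comment> \<open>For the purifier the entropy is read off the complement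
      \<open>{1..N}\<close>.\<close>
    then have "entropy N S {l} = S (if l = 0 then {1..N} else {l})"
      by (auto simp: entropy_def intro!: arg_cong[of _ _ S])
    moreover have "S (if l = 0 then {1..N} else {l}) \<noteq> 0"
      using irr l \<open>N \<ge> 1\<close> unfolding irreducible_entropy_def by simp
    ultimately show ?thesis by simp
  qed
  ultimately show False by blast
qed

section \<open>Cuts in the tree model\<close>

text \<open>Edges need only go to linked pairs, so \<open>f\<close> may contract some of
  them.\<close>

lemma linked_map:
  assumes "linked E x y" "\<And>a b. {a, b} \<in> E \<Longrightarrow> linked E' (f a) (f b)"
  shows "linked E' (f x) (f y)"
  using assms(1)
proof (induction rule: linked_induct)
  case (step y z)
  then show ?case
    using linked_trans[OF step.IH assms(2)] by simp
qed simp

text \<open>Deleting one edge splits a component into at most two, so two of the three vertices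
  share one.\<close>

lemma linked_remove_edge_three:
  assumes "linked E a b" "linked E a c" "{p, q} \<in> E"
  shows "linked (E - {{p, q}}) a b \<or> linked (E - {{p, q}}) a c \<or> linked (E - {{p, q}}) b c"
    (is "?L a b \<or> ?L a c \<or> ?L b c")
proof -
  have trans: "?L a p \<Longrightarrow> ?L p b \<Longrightarrow> ?L a b" "?L a q \<Longrightarrow> ?L q b \<Longrightarrow> ?L a b"
    "?L q b \<Longrightarrow> ?L q c \<Longrightarrow> ?L b c" "?L p b \<Longrightarrow> ?L p c \<Longrightarrow> ?L b c"
    by (metis linked_trans, metis linked_trans, metis linked_trans linked_sym, metis linked_trans linked_sym)
  show ?thesis
    using linked_remove_edge[OF assms(1,3)] linked_remove_edge[OF assms(2,3)] trans by blast
qed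

section \<open>Edges of a forest crossed by a vertex set\<close>

lemma card_doubleton_Int_eq_1:
  "u \<noteq> v \<Longrightarrow> card ({u, v} \<inter> C) = 1 \<longleftrightarrow> (u \<in> C) \<noteq> (v \<in> C)"
  by (cases "u \<in> C"; cases "v \<in> C") simp_all

lemma crossing_edgeE:
  assumes "forest E" "e \<in> E" "card (e \<inter> C) = 1"
  obtains p q where "e = {p, q}" "p \<in> C" "q \<notin> C"
proof -
  obtain u v where uv: "e = {u, v}" "u \<noteq> v"
    using assms(1,2) by (rule forestE)
  then have "(u \<in> C) \<noteq> (v \<in> C)"
    using assms(3) card_doubleton_Int_eq_1 by metis
  then show thesis
    using that[of u v] that[of v u] uv by auto
qed

text \<open>\<open>C\<close> stays connected without its crossing edges. A walk that has left
  \<open>C\<close> through \<open>e\<close> could reach \<open>e'\<close> only by returning to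
  \<open>C\<close>, which would close a detour around a bridge.\<close>

lemma crossing_branches_disjoint:
  assumes E: "forest E"
    and e: "e \<in> E" "card (e \<inter> C) = 1" and e': "e' \<in> E" "card (e' \<inter> C) = 1" and ne: "e \<noteq> e'"
    and conn: "\<And>u v. u \<in> C \<Longrightarrow> v \<in> C \<Longrightarrow> linked {f \<in> E. f \<subseteq> C} u v"
    and r: "r \<in> C" "linked E r x" "\<not> linked (E - {e}) r x"
  shows "linked (E - {e'}) r x"
proof (rule ccontr)
  assume nl: "\<not> linked (E - {e'}) r x"
  obtain p q where pq: "e = {p, q}" "p \<in> C" "q \<notin> C"
    using E e by (rule crossing_edgeE)
  obtain p' q' where pq': "e' = {p', q'}" "p' \<in> C" "q' \<notin> C"
    using E e' by (rule crossing_edgeE)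
  let ?H = "E - {e} - {e'}"
  have H: "linked (E - {e}) u v" "linked (E - {e'}) u v" if "linked ?H u v" for u v
    using that by (rule linked_mono; blast)+
  have inner: "linked ?H u v" if "u \<in> C" "v \<in> C" for u v
    using conn[OF that] by (rule linked_mono) (use pq pq' in auto)
  have bridge: "\<not> linked (E - {e}) p q"
    using forest_bridge[OF E, of p q] e pq by simp
  have "linked (E - {e}) r p \<and> linked (E - {e}) q x \<or> linked (E - {e}) r q"
    using linked_remove_edge[of E r x p q] r e pq by auto
  moreover have "\<not> linked (E - {e}) r q"
    using linked_trans[OF H(1)[OF inner[OF pq(2) r(1)]]] bridge by blast
  ultimately have "linked (E - {e}) q x"
    by blast
  then consider "linked ?H q x" | "linked ?H q p'" | "linked ?H p' x"
    using linked_remove_edge[of "E - {e}" q x p' q'] e' pq' ne by auto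
  then show False
  proof cases
    case 1
    have "linked (E - {e'}) p q"
      using e pq ne by (intro linked_edge) auto
    then have "linked (E - {e'}) r q"
      by (rule linked_trans[OF H(2)[OF inner[OF r(1) pq(2)]]])
    then show False
      using linked_trans[OF _ H(2)[OF 1]] nl by blast
  next
    case 2
    have "linked ?H p q"
      by (rule linked_trans[OF inner[OF pq(2) pq'(2)] linked_sym[OF 2]])
    then show False
      using H(1) bridge by blast
  next
    case 3
    have "linked ?H r x"
      by (rule linked_trans[OF inner[OF r(1) pq'(2)] 3])
    then show False
      using H(2) nl by blast
  qed
qed

text \<open>A step of a walk from \<open>r\<close> changes the status of its own edge only, which
  starts or stops separating the current vertex from \<open>r\<close>; membership in
  \<open>C\<close> changes exactly when this edge is crossing.\<close>

lemma forest_cut_parity: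
  assumes E: "forest E" "finite E" and r: "r \<notin> C" and v: "linked E r v"
  shows "v \<in> C \<longleftrightarrow> odd (card {e \<in> E. card (e \<inter> C) = 1 \<and> \<not> linked (E - {e}) r v})"
  using v
proof (induction rule: linked_induct)
  case refl
  then show ?case
    using r by simp
next
  case (step y z)
  let ?D = "\<lambda>v. {e \<in> E. card (e \<inter> C) = 1 \<and> \<not> linked (E - {e}) r v}"
  let ?f = "{y, z}"
  have bridge: "\<not> linked (E - {?f}) y z"
    using forest_bridge[OF E(1) step.hyps(2)] .
  then have yz: "y \<noteq> z" by auto
  have other: "linked (E - {e}) r y \<longleftrightarrow> linked (E - {e}) r z" if "e \<noteq> ?f" for e
  proof -
    have "linked (E - {e}) y z"
      using that step.hyps(2) by (intro linked_edge) auto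
    then show ?thesis
      using linked_trans linked_sym by metis
  qed
  have "linked (E - {?f}) r y \<noteq> linked (E - {?f}) r z"
    using linked_remove_edge[OF step.hyps] bridge
      linked_trans[OF linked_sym, of "E - {?f}" r y z] by blast
  then have iff: "?f \<in> ?D z \<longleftrightarrow> card (?f \<inter> C) = 1 \<and> ?f \<notin> ?D y"
    using step.hyps(2) by auto
  have eq: "?D z - {?f} = ?D y - {?f}"
    using other by auto
  have fin: "finite (?D v)" for v
    using E(2) by simp
  show ?case
  proof (cases "card (?f \<inter> C) = 1")
    case True
    have parity: "odd m \<noteq> odd n" if "m = Suc n \<or> n = Suc m" for m n :: nat
      using that by auto
    have "odd (card (?D z)) \<noteq> odd (card (?D y))"
    proof (cases "?f \<in> ?D y")
      case f: True
      then have *: "?D z = ?D y - {?f}"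
        using iff eq by auto
      show ?thesis
        unfolding * using card_Suc_Diff1[OF fin f] by (intro parity disjI2) (rule sym)
    next
      case f: False
      then have *: "?D z = insert ?f (?D y)"
        using iff eq True by auto
      show ?thesis
        unfolding * using card_insert_disjoint[OF fin f] by (intro parity disjI1)
    qed
    moreover have "(y \<in> C) \<noteq> (z \<in> C)"
      using True card_doubleton_Int_eq_1[OF yz] by blast
    ultimately show ?thesis
      using step.IH by blast
  next
    case False
    then have "?D z = ?D y"
      using iff eq by auto
    moreover have "(y \<in> C) = (z \<in> C)"
      using False card_doubleton_Int_eq_1[OF yz] by blast
    ultimately show ?thesis
      using step.IH by simp
  qed
qed

text \<open>A detour around a bulk edge projects to \<open>T'\<close> once each leaf is contracted
  to its attachment; a leaf edge is the only edge at its leaf.\<close>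

lemma forest_add_leaves:
  assumes T': "forest (edges T')"
  shows "forest (edges (add_leaves N S T'))"
  unfolding forest_def
proof
  let ?E = "edges (add_leaves N S T')"
  have E: "?E = (\<lambda>e. Bulk ` e) ` edges T' \<union> {{Boundary l, Bulk (attachment N S l)} | l. l \<in> {0..N}}"
    by (simp add: add_leaves_def)
  fix e
  assume "e \<in> ?E"
  then consider e0 where "e0 \<in> edges T'" "e = Bulk ` e0"
    | l where "e = {Boundary l, Bulk (attachment N S l)}"
    unfolding E by blast
  then show "\<exists>u v. e = {u, v} \<and> \<not> linked (?E - {e}) u v"
  proof cases
    case 1
    have "\<exists>u v. e0 = {u, v} \<and> \<not> linked (edges T' - {e0}) u v"
      using T' 1(1) unfolding forest_def by (rule bspec)
    then obtain u v where uv: "e0 = {u, v}" "\<not> linked (edges T' - {e0}) u v"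
      by (elim exE conjE)
    define f where "f = case_model_vertex (attachment N S) id"
    have f: "f (Boundary l) = attachment N S l" "f (Bulk Q) = Q" for l Q
      by (simp_all add: f_def)
    have "linked (edges T' - {e0}) (f a) (f b)" if ab: "{a, b} \<in> ?E - {e}" for a b
    proof -
      from ab consider e1 where "e1 \<in> edges T'" "e1 \<noteq> e0" "{a, b} = Bulk ` e1"
        | l where "{a, b} = {Boundary l, Bulk (attachment N S l)}"
        using 1 unfolding E by blast
      then show ?thesis
      proof cases
        case 1
        have "f ` {a, b} = e1"
          unfolding 1(3) image_image f by simp
        then have "{f a, f b} = e1"
          by simp
        then show ?thesis
          using 1(1,2) by (intro linked_edge) simp
      next
        case 2
        then show ?thesis
          by (auto simp: doubleton_eq_iff f)
      qed
    qed
    then have "\<not> linked (?E - {e}) (Bulk u) (Bulk v)"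
      using linked_map[of "?E - {e}" "Bulk u" "Bulk v" "edges T' - {e0}" f] uv f by auto
    then show ?thesis
      using 1 uv by auto
  next
    case 2
    have "x = Boundary l" if "linked (?E - {e}) (Boundary l) x" for x
      using that
    proof (induction rule: linked_induct)
      case (step y z)
      have in_E: "{Boundary l, z} \<in> ?E" "{Boundary l, z} \<noteq> e"
        using step.hyps(2) unfolding step.IH by simp_all
      have "{Boundary l, z} \<noteq> Bulk ` e1" for e1
        by blast
      then obtain k where k: "{Boundary l, z} = {Boundary k, Bulk (attachment N S k)}"
        using in_E(1) unfolding E by auto
      then have "k = l"
        by (simp add: doubleton_eq_iff)
      then show ?case
        using k in_E(2) 2 by simp
    qed simp
    then have "\<not> linked (?E - {e}) (Boundary l) (Bulk (attachment N S l))"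
      by blast
    with 2 show ?thesis by blast
  qed
qed

section \<open>The tree model\<close>

locale tree_model =
  fixes N :: nat and S :: "nat set \<Rightarrow> real" and T' :: "nat set set sgraph"
    and T :: "model_vertex sgraph" and w :: "model_vertex set \<Rightarrow> real"
  assumes N: "N \<ge> 1"
    and irr: "irreducible_entropy N S"
    and chordal: "chordal (line_graph N S)"
    and max_weight: "max_weight_spanning_tree (clique_graph N S) clique_weight T'"
    and T: "T = add_leaves N S T'"
    and w: "\<And>e. e \<in> edges T \<Longrightarrow> w e = edge_weight N S T e"
begin

lemma SA: "SA N S" and SSA: "SSA N S"
  using irr by (auto simp: irreducible_entropy_def)

lemma finite_line_graph: "finite (verts (line_graph N S))"
  by (simp add: line_graph_def finite_hyperedges)

text \<open>The hyperedges through \<open>l\<close> pairwise meet in \<open>l\<close>, so they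
  extend to a max-clique; uniqueness lets the definite description denote it.\<close>

lemma attachment:
  assumes "l \<le> N"
  shows "max_clique (line_graph N S) (attachment N S l) \<and> party_clique N S l \<subseteq> attachment N S l"
proof -
  have "clique (line_graph N S) (party_clique N S l)"
    by (auto simp: clique_line_graph_iff party_clique_def)
  then obtain Q where "max_clique (line_graph N S) Q" "party_clique N S l \<subseteq> Q"
    using clique_extends_to_max_clique[OF finite_line_graph] by blast
  then have "\<exists>!Q. max_clique (line_graph N S) Q \<and> party_clique N S l \<subseteq> Q"
    using max_clique_through_party_unique[OF N irr assms] by blast
  then show ?thesis
    unfolding attachment_def by (rule theI')
qed

lemma tree_T': "tree T'" and verts_T': "verts T' = {Q. max_clique (line_graph N S) Q}"
  using max_weight
  by (auto simp: max_weight_spanning_tree_def spanning_tree_def clique_graph_def Let_def)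

lemma T'_edge: "{P, R} \<in> edges T' \<Longrightarrow> P \<in> verts T' \<and> R \<in> verts T'"
  using tree_T' by (auto simp: tree_def simple_graph_def doubleton_eq_iff)

lemma clique_tree:
  assumes "P \<in> verts T'" "R \<in> verts T'" "h \<in> P \<inter> R"
  shows "linked {f \<in> edges T'. h \<in> \<Inter>f} P R"
proof (rule max_weight_spanning_tree_is_clique_tree[OF chordal line_graph_simple finite_line_graph])
  have "clique_weight = (\<lambda>e. card (\<Inter>e))"
    by (simp add: clique_weight_def fun_eq_iff)
  then show "max_weight_spanning_tree (clique_graph N S) (\<lambda>e. card (\<Inter>e)) T'"
    using max_weight by simp
qed (use assms in \<open>auto simp: clique_graph_def Let_def verts_T'\<close>)

lemma edges_T:
  "edges T = (\<lambda>e. Bulk ` e) ` edges T' \<union> {{Boundary l, Bulk (attachment N S l)} | l. l \<in> {0..N}}"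
  and verts_T: "verts T = Bulk ` verts T' \<union> Boundary ` {0..N}"
  by (simp_all add: T add_leaves_def)

lemma forest_T: "forest (edges T)"
  unfolding T by (intro forest_add_leaves tree_forest tree_T')

lemma finite_verts_T: "finite (verts T)"
proof -
  have "verts T' \<subseteq> Pow (verts (line_graph N S))"
    by (auto simp: verts_T' max_clique_def clique_def)
  then show ?thesis
    using finite_line_graph by (auto simp: verts_T intro: finite_subset)
qed

lemma finite_edges_T: "finite (edges T)"
proof (rule finite_subset)
  have "e \<subseteq> verts T'" if "e \<in> edges T'" for e
    using that tree_T' by (auto simp: tree_def simple_graph_def)
  then show "edges T \<subseteq> Pow (verts T)"
    using attachment by (fastforce simp: edges_T verts_T verts_T')
qed (simp add: finite_verts_T)

lemma leaf_linked: "l \<le> N \<Longrightarrow> linked (edges T) (Boundary l) (Bulk (attachment N S l))"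
  by (intro linked_edge) (auto simp: edges_T)

lemma linked_T:
  assumes "u \<in> verts T" "v \<in> verts T"
  shows "linked (edges T) u v"
proof -
  have bulk: "linked (edges T) (Bulk P) (Bulk R)" if "P \<in> verts T'" "R \<in> verts T'" for P R
  proof (rule linked_map[where E = "edges T'" and f = Bulk])
    show "linked (edges T') P R"
      using that tree_T' by (auto simp: tree_def reachable_eq_linked)
    show "linked (edges T) (Bulk a) (Bulk b)" if "{a, b} \<in> edges T'" for a b
      using that by (intro linked_edge) (auto simp: edges_T image_iff intro!: bexI[of _ "{a, b}"])
  qed
  have "\<exists>P \<in> verts T'. linked (edges T) x (Bulk P)" if "x \<in> verts T" for x
  proof (cases x)
    case (Boundary l)
    then show ?thesis
      using that leaf_linked[of l] attachment[of l] by (auto simp: verts_T verts_T')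
  next
    case (Bulk P)
    then show ?thesis
      using that by (intro bexI[of _ P]) (auto simp: verts_T)
  qed
  then obtain P R where PR: "P \<in> verts T'" "R \<in> verts T'"
      "linked (edges T) u (Bulk P)" "linked (edges T) v (Bulk R)"
    using assms by blast
  show ?thesis
    by (rule linked_trans[OF linked_trans[OF PR(3) bulk[OF PR(1,2)]] linked_sym[OF PR(4)]])
qed

section \<open>Edge weights as entropies of branches\<close>

definition branch :: "model_vertex \<Rightarrow> model_vertex set \<Rightarrow> nat set" where
  "branch r e = {l \<in> {0..N}. \<not> linked (edges T - {e}) r (Boundary l)}"

lemma branch_subset: "branch r e \<subseteq> {0..N}"
  by (auto simp: branch_def)

lemma boundary_in_verts: "l \<le> N \<Longrightarrow> Boundary l \<in> verts T"
  by (simp add: verts_T)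

lemma weight_eq_entropy_root:
  assumes "e \<in> edges T"
  shows "w e = entropy N S (branch (Boundary 0) e)"
proof -
  have "edge_parties N T e = branch (Boundary 0) e"
    by (simp add: edge_parties_def branch_def reachable_eq_linked delete_edge_def)
  moreover have "0 \<notin> branch (Boundary 0) e"
    by (simp add: branch_def)
  ultimately show ?thesis
    using w[OF assms] by (auto simp: edge_weight_def entropy_def Let_def)
qed

text \<open>The root only decides which of the two complementary sides of \<open>e\<close> is the
  branch, and purity gives both sides the same entropy.\<close>

lemma weight_eq_entropy:
  assumes e: "e \<in> edges T" and r: "r \<in> verts T"
  shows "w e = entropy N S (branch r e)"
proof -
  obtain p q where pq: "e = {p, q}"
    using forest_T e by (rule forestE)
  let ?L = "linked (edges T - {e})"
  show ?thesis
  proof (cases "?L (Boundary 0) r")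
    case True
    then have "?L (Boundary 0) x \<longleftrightarrow> ?L r x" for x
      using linked_trans linked_sym by metis
    then show ?thesis
      by (simp add: weight_eq_entropy_root[OF e] branch_def)
  next
    case False
    have "?L (Boundary 0) (Boundary l) \<longleftrightarrow> \<not> ?L r (Boundary l)" if "l \<le> N" for l
    proof -
      have "?L (Boundary 0) r \<or> ?L (Boundary 0) (Boundary l) \<or> ?L r (Boundary l)"
        unfolding pq
        by (rule linked_remove_edge_three) (use e pq r that linked_T boundary_in_verts in auto)
      moreover have "\<not> (?L (Boundary 0) (Boundary l) \<and> ?L r (Boundary l))"
        using False linked_trans[of "edges T - {e}" "Boundary 0" "Boundary l" r]
          linked_sym[of "edges T - {e}" r "Boundary l"] by blast
      ultimately show ?thesis
        using False by blast
    qed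
    then have "branch r e = {0..N} - branch (Boundary 0) e"
      by (auto simp: branch_def)
    then show ?thesis
      using weight_eq_entropy_root[OF e] entropy_compl[OF branch_subset] by simp
  qed
qed

lemma weight_nonneg: "e \<in> edges T \<Longrightarrow> w e \<ge> 0"
  using weight_eq_entropy_root entropy_nonneg[OF SA branch_subset] by simp

section \<open>Lower bound for all cuts\<close>

lemma cut_cost_lower_bound:
  assumes C: "is_cut N T X C" and X: "X \<subseteq> {1..N}"
  shows "entropy N S X \<le> cut_cost T w C"
proof -
  let ?F = "{e \<in> edges T. card (e \<inter> C) = 1}"
  have in_C: "Boundary l \<in> C \<longleftrightarrow> l \<in> X" if "l \<le> N" for l
  proof -
    have "Boundary l \<in> C \<inter> Boundary ` {0..N} \<longleftrightarrow> Boundary l \<in> Boundary ` X"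
      using C by (simp add: is_cut_def)
    then show ?thesis
      using that by auto
  qed
  \<comment> \<open>\<open>X\<close> avoids the purifier, which therefore lies outside
    \<open>C\<close> and can be the root of the parity count.\<close>
  have root: "Boundary 0 \<notin> C"
    using in_C[of 0] X by auto
  have parity: "l \<in> X \<longleftrightarrow> odd (card {e \<in> ?F. l \<in> branch (Boundary 0) e})" if "l \<le> N" for l
  proof -
    have "{e \<in> ?F. l \<in> branch (Boundary 0) e}
        = {e \<in> edges T. card (e \<inter> C) = 1 \<and> \<not> linked (edges T - {e}) (Boundary 0) (Boundary l)}"
      using that by (auto simp: branch_def)
    moreover have "linked (edges T) (Boundary 0) (Boundary l)"
      using that by (intro linked_T boundary_in_verts) auto
    ultimately show ?thesis
      using forest_cut_parity[OF forest_T finite_edges_T root] in_C[OF that] by simp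
  qed
  have "X = {l \<in> {0..N}. odd (card {e \<in> ?F. l \<in> branch (Boundary 0) e})}"
  proof (rule set_eqI)
    fix l
    show "l \<in> X \<longleftrightarrow> l \<in> {l \<in> {0..N}. odd (card {e \<in> ?F. l \<in> branch (Boundary 0) e})}"
      using parity[of l] X by (cases "l \<le> N") auto
  qed
  then have "entropy N S X \<le> (\<Sum>e\<in>?F. entropy N S (branch (Boundary 0) e))"
    using entropy_odd_cover[OF SA SSA, of ?F "branch (Boundary 0)"] finite_edges_T branch_subset
    by simp
  also have "\<dots> = cut_cost T w C"
    unfolding cut_cost_def by (intro sum.cong) (auto simp: weight_eq_entropy_root)
  finally show ?thesis .
qed

section \<open>Cuts that attain the entropy\<close>

definition region :: "nat set \<Rightarrow> model_vertex set" where
  "region X = Boundary ` X \<union> Bulk ` {Q \<in> verts T'. X \<in> Q}"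

text \<open>The max-cliques containing \<open>X\<close> span a subtree, and each party of
  \<open>X\<close> is attached to a max-clique that contains all hyperedges through it,
  \<open>X\<close> among them.\<close>

lemma region_connected:
  assumes X: "X \<in> hyperedges N S" and uv: "u \<in> region X" "v \<in> region X"
  shows "linked {f \<in> edges T. f \<subseteq> region X} u v"
proof -
  let ?E = "{f \<in> edges T. f \<subseteq> region X}"
  have bulk: "linked ?E (Bulk P) (Bulk R)" if "P \<in> verts T'" "R \<in> verts T'" "X \<in> P \<inter> R" for P R
  proof (rule linked_map[OF clique_tree[OF that], where f = Bulk])
    fix a b
    assume ab: "{a, b} \<in> {f \<in> edges T'. X \<in> \<Inter>f}"
    then have "{Bulk a, Bulk b} \<in> edges T"
      by (auto simp: edges_T image_iff intro!: bexI[of _ "{a, b}"])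
    then show "linked ?E (Bulk a) (Bulk b)"
      using ab T'_edge[of a b] by (intro linked_edge) (auto simp: region_def)
  qed
  have "\<exists>P \<in> verts T'. X \<in> P \<and> linked ?E x (Bulk P)" if "x \<in> region X" for x
    using that[unfolded region_def]
  proof (elim UnE imageE)
    fix l
    assume l: "x = Boundary l" "l \<in> X"
    then have "l \<le> N"
      using X by (auto simp: hyperedges_def)
    then have P: "attachment N S l \<in> verts T'" "X \<in> attachment N S l"
      using attachment[of l] X l(2) by (auto simp: verts_T' party_clique_def)
    have "{x, Bulk (attachment N S l)} \<in> ?E"
      using l \<open>l \<le> N\<close> P by (auto simp: edges_T region_def)
    then show "\<exists>P \<in> verts T'. X \<in> P \<and> linked ?E x (Bulk P)"
      using P by (intro bexI[of _ "attachment N S l"] conjI linked_edge)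
  qed auto
  then obtain P R where PR: "P \<in> verts T'" "R \<in> verts T'" "X \<in> P" "X \<in> R"
      "linked ?E u (Bulk P)" "linked ?E v (Bulk R)"
    using uv by blast
  have "linked ?E (Bulk P) (Bulk R)"
    using PR by (intro bulk) auto
  then show ?thesis
    by (rule linked_trans[OF linked_trans[OF PR(5)] linked_sym[OF PR(6)]])
qed

text \<open>Stated for an arbitrary connected \<open>C\<close> so as to cover single leaves as well
  as regions; for a leaf, \<open>avoid\<close> is automatic.\<close>

lemma connected_cut_cost_upper_bound:
  assumes X: "X \<subseteq> {0..N}" and C: "Boundary ` X \<subseteq> C" "x \<in> X" "C \<subseteq> verts T"
    and conn: "\<And>u v. u \<in> C \<Longrightarrow> v \<in> C \<Longrightarrow> linked {f \<in> edges T. f \<subseteq> C} u v"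
    and avoid: "\<And>Z. Z \<in> hyperedges N S \<Longrightarrow> Z \<inter> X = {} \<Longrightarrow> region Z \<inter> C = {}"
  shows "cut_cost T w C \<le> entropy N S X"
proof -
  let ?F = "{e \<in> edges T. card (e \<inter> C) = 1}"
  let ?V = "{0..N} - X"
  let ?B = "branch (Boundary x)"
  have x: "Boundary x \<in> C" "Boundary x \<in> verts T"
    using C by auto
  \<comment> \<open>A crossed edge does not lie inside \<open>C\<close>, so removing it keeps all of
    \<open>X\<close> linked to the root.\<close>
  have in_branch: "?B e \<inter> ?V = ?B e" if "e \<in> ?F" for e
  proof -
    have "linked (edges T - {e}) (Boundary x) (Boundary l)" if "l \<in> X" for l
    proof (rule linked_mono[OF conn])
      show "{f \<in> edges T. f \<subseteq> C} \<subseteq> edges T - {e}"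
        using forest_T \<open>e \<in> ?F\<close> by (auto elim!: crossing_edgeE)
    qed (use x C that in auto)
    then show ?thesis
      by (auto simp: branch_def)
  qed
  have "(\<Sum>e\<in>?F. entropy N S (?B e \<inter> ?V)) \<le> entropy N S ?V"
  proof (rule entropy_superadditive[OF SA _ subset_refl])
    show "?B e \<inter> ?B e' \<inter> ?V = {}" if "e \<in> ?F" "e' \<in> ?F" "e \<noteq> e'" for e e'
    proof -
      have "linked (edges T - {e'}) (Boundary x) (Boundary l)"
        if "l \<le> N" "\<not> linked (edges T - {e}) (Boundary x) (Boundary l)" for l
        using crossing_branches_disjoint[OF forest_T _ _ _ _ \<open>e \<noteq> e'\<close> conn x(1)] that
          \<open>e \<in> ?F\<close> \<open>e' \<in> ?F\<close> linked_T[OF x(2) boundary_in_verts] by blast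
      then show ?thesis
        by (auto simp: branch_def)
    qed
    show "Z \<subseteq> ?B e" if Z: "Z \<in> hyperedges N S" "Z \<subseteq> ?V" "?B e \<inter> Z \<noteq> {}" and e: "e \<in> ?F" for Z e
    proof
      fix z'
      assume z': "z' \<in> Z"
      obtain z where z: "z \<in> Z" "z \<in> ?B e"
        using Z(3) by blast
      \<comment> \<open>The region joins all parties of \<open>Z\<close> without touching
        \<open>C\<close>, whereas \<open>e\<close> has an end in \<open>C\<close>; removing
        \<open>e\<close> thus keeps \<open>Z\<close> on one side.\<close>
      have "region Z \<inter> C = {}"
        using avoid[OF Z(1)] Z(2) by blast
      moreover have "e \<inter> C \<noteq> {}"
        using e by force
      ultimately have "{f \<in> edges T. f \<subseteq> region Z} \<subseteq> edges T - {e}"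
        by blast
      then have "linked (edges T - {e}) (Boundary z') (Boundary z)"
        by (intro linked_mono[OF region_connected[OF Z(1)]]) (use z z' in \<open>auto simp: region_def\<close>)
      then have "\<not> linked (edges T - {e}) (Boundary x) (Boundary z')"
        using z(2) linked_trans[of "edges T - {e}" "Boundary x" "Boundary z'" "Boundary z"]
        by (auto simp: branch_def)
      then show "z' \<in> ?B e"
        using z' Z(2) by (auto simp: branch_def)
    qed
  qed (use finite_edges_T in auto)
  moreover have "(\<Sum>e\<in>?F. entropy N S (?B e \<inter> ?V)) = cut_cost T w C"
    unfolding cut_cost_def
    by (intro sum.cong refl) (simp add: in_branch weight_eq_entropy[OF _ x(2)])
  ultimately show ?thesis
    using entropy_compl[OF X] by simp
qed

lemma cut_cost_Un: "cut_cost T w (C \<union> D) \<le> cut_cost T w C + cut_cost T w D"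
proof -
  let ?F = "\<lambda>C. {e \<in> edges T. card (e \<inter> C) = 1}"
  \<comment> \<open>The outer end of such an edge lies outside both cuts, so whichever cut contains
    the inner end is crossed as well.\<close>
  have "?F (C \<union> D) \<subseteq> ?F C \<union> ?F D"
  proof
    fix e
    assume e: "e \<in> ?F (C \<union> D)"
    then obtain p q where "e = {p, q}" "p \<noteq> q"
      using forest_T by (auto elim: forestE)
    then show "e \<in> ?F C \<union> ?F D"
      using e card_doubleton_Int_eq_1[of p q] by auto
  qed
  then have "cut_cost T w (C \<union> D) \<le> sum w (?F C \<union> ?F D)"
    unfolding cut_cost_def using finite_edges_T weight_nonneg by (intro sum_mono2) auto
  also have "\<dots> \<le> sum w (?F C \<union> ?F D) + sum w (?F C \<inter> ?F D)"
    using weight_nonneg by (auto intro!: sum_nonneg)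
  also have "\<dots> = cut_cost T w C + cut_cost T w D"
    unfolding cut_cost_def using finite_edges_T by (intro sum.union_inter) auto
  finally show ?thesis .
qed

lemma cut_cost_upper_bound:
  assumes "X \<subseteq> {0..N}" "X \<noteq> {}"
  shows "\<exists>C. is_cut N T X C \<and> cut_cost T w C \<le> entropy N S X"
  using assms
proof (induction X rule: hyperedge_induct[where S = S])
  case (singleton l)
  have "cut_cost T w {Boundary l} \<le> entropy N S {l}"
    by (rule connected_cut_cost_upper_bound[where x = l])
      (use singleton in \<open>auto simp: verts_T region_def\<close>)
  moreover have "is_cut N T {l} {Boundary l}"
    using singleton by (auto simp: is_cut_def verts_T)
  ultimately show ?case by blast
next
  case (hyperedge X)
  have X: "X \<subseteq> {0..N}"
    using hyperedge by (simp add: hyperedges_def)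
  obtain x where x: "x \<in> X"
    using hyperedge_nonempty[OF hyperedge] by blast
  \<comment> \<open>Consequently no max-clique contains two disjoint hyperedges, and their regions
    are disjoint.\<close>
  have meet: "Y \<inter> Z \<noteq> {}" if "Q \<in> verts T'" "Y \<in> Q" "Z \<in> Q" for Q Y Z
    using that by (auto simp: verts_T' max_clique_def clique_line_graph_iff)
  have "region Z \<inter> region X = {}" if "Z \<inter> X = {}" for Z
    using that meet[of _ Z X] by (auto simp: region_def)
  then have "cut_cost T w (region X) \<le> entropy N S X"
    by (intro connected_cut_cost_upper_bound[OF X _ x] region_connected[OF hyperedge])
      (use X in \<open>auto simp: region_def verts_T\<close>)
  moreover have "is_cut N T X (region X)"
    using X by (auto simp: is_cut_def region_def verts_T)
  ultimately show ?case by blast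
next
  case (split Y Z)
  then obtain C D where "is_cut N T Y C" "is_cut N T Z D"
      "cut_cost T w C \<le> entropy N S Y" "cut_cost T w D \<le> entropy N S Z"
    by blast
  moreover have "is_cut N T (Y \<union> Z) (C \<union> D)" if "is_cut N T Y C" "is_cut N T Z D"
    using that by (auto simp: is_cut_def Int_Un_distrib2 image_Un)
  ultimately show ?case
    using cut_cost_Un[of C D] split(5) by (intro exI[of _ "C \<union> D"]) auto
qed

lemma model_realizes: "realizes N T w S"
  unfolding realizes_def
proof (intro allI impI)
  fix X
  assume X: "X \<subseteq> {1..N} \<and> X \<noteq> {}"
  then have "0 \<notin> X" "X \<noteq> {0..N}" "X \<subseteq> {0..N}"
    by auto
  then have S_X: "entropy N S X = S X"
    using X by (simp add: entropy_def)
  obtain C where "is_cut N T X C" "cut_cost T w C \<le> S X"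
    using cut_cost_upper_bound[of X] \<open>X \<subseteq> {0..N}\<close> X S_X by auto
  moreover have lower: "S X \<le> cut_cost T w C" if "is_cut N T X C" for C
    using cut_cost_lower_bound[OF that] X S_X by simp
  ultimately have C: "is_cut N T X C" "S X = cut_cost T w C"
    by (auto intro: antisym)
  show "Min {cut_cost T w C | C. is_cut N T X C} = S X"
  proof (rule Min_eqI)
    have "{cut_cost T w C | C. is_cut N T X C} \<subseteq> cut_cost T w ` Pow (verts T)"
      by (auto simp: is_cut_def)
    then show "finite {cut_cost T w C | C. is_cut N T X C}"
      using finite_verts_T by (meson finite_Pow_iff finite_imageI finite_subset)
  qed (use lower C in auto)
qed

end

theorem theorem3:
  fixes N :: nat
    and S :: "nat set \<Rightarrow> real"
    and T :: "model_vertex sgraph"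
    and w :: "model_vertex set \<Rightarrow> real"
  assumes "N \<ge> 1"
    and "irreducible_entropy N S"
    and "chordal (line_graph N S)"
    and "simple_tree_model N S T w"
  shows "realizes N T w S"
proof -
  obtain T' where "max_weight_spanning_tree (clique_graph N S) clique_weight T'"
      "T = add_leaves N S T'" "\<And>e. e \<in> edges T \<Longrightarrow> w e = edge_weight N S T e"
    using assms(4) unfolding simple_tree_model_def by blast
  then interpret tree_model N S T' T w
    using assms by unfold_locales auto
  show ?thesis
    by (rule model_realizes)
qed

end
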